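(* For any prime $p\ge 5$, we have both $$\sum_{k=0}^{p-1}(-1)^kf_kH_k^{(2)}\equiv \frac{1}{2}B_{p-2}\left(\frac{1}{3}\right)\pmod{p}$$ and $$\sum_{k=0}^{p-1}(-1)^kf_kH_k\equiv -2\left(\frac{p}{3}\right)q_p(3) \pmod{p}.$$
   Context: The Franel numbers are $f_n=\sum_{k=0}^n\binom{n}{k}^3$ for $n\ge 0$. The generalized harmonic numbers are $H_k^{(r)}=\sum_{j=1}^k\frac{1}{j^r}$ (with $H_0^{(r)}=0$), and $H_k=H_k^{(1)}$. The Bernoulli polynomials $B_k(t)$ are defined by $\frac{xe^{tx}}{e^x-1}=\sum_{k=0}^{\infty}B_k(t)\frac{x^k}{k!}$. $\left(\frac{\cdot}{3}\right)$ denotes the Legendre symbol modulo $3$ (so $\left(\frac{a}{3}\right)=0,1,-1$ according as $a\equiv 0,1,2\pmod 3$). $q_p(3)=(3^{p-1}-1)/p$ is the Fermat quotient. A congruence modulo $p$ between rational numbers is understood in the ring of rational numbers whose denominators are coprime to $p$ (i.e. the difference is $p$ times a rational number with denominator coprime to $p$). *)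

theory Defs
  imports
    "HOL-Computational_Algebra.Computational_Algebra"
    "HOL-Number_Theory.Number_Theory"
begin

definition franel :: "nat \<Rightarrow> nat" where
  "franel n = (\<Sum>k=0..n. (n choose k) ^ 3)"

(* The library's harm lives in real_normed_field, which excludes rat. *)
definition gen_harm :: "nat \<Rightarrow> nat \<Rightarrow> rat" where
  "gen_harm r k = (\<Sum>j=1..k. 1 / of_nat j ^ r)"

(* k! times the coefficient of x^k in x e^(tx) / (e^x - 1).  The divisor has zero constant term,
   so this uses the division of formal power series that cancels the common power of x;
   bernpoly_generating_function states that the quotient is exact. *)
definition bernpoly :: "nat \<Rightarrow> 'a :: field_char_0 \<Rightarrow> 'a" where
  "bernpoly k t = fact k * fps_nth (fps_X * fps_exp t / (fps_exp 1 - 1)) k"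

lemma bernpoly_generating_function:
  fixes t :: "'a :: field_char_0"
  shows "Abs_fps (\<lambda>k. bernpoly k t / fact k) * (fps_exp 1 - 1) = fps_X * fps_exp t"
proof -
  let ?d = "fps_exp 1 - 1 :: 'a fps"
  have d1: "fps_nth ?d 1 \<noteq> 0"
    by simp
  then have nz: "?d \<noteq> 0"
    by (metis fps_zero_nth)
  have "subdegree ?d \<le> 1"
    using d1 by (rule subdegree_leI)
  also have "1 \<le> subdegree (fps_X * fps_exp t)"
    by (rule subdegree_geI) (auto simp: fps_eq_iff intro!: exI[of _ 1])
  finally have "?d dvd fps_X * fps_exp t"
    using nz by (simp add: fps_dvd_iff)
  moreover have "Abs_fps (\<lambda>k. bernpoly k t / fact k) = fps_X * fps_exp t / ?d"
    by (simp add: fps_eq_iff bernpoly_def)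
  ultimately show ?thesis
    by simp
qed

definition fermat_quotient :: "nat \<Rightarrow> nat \<Rightarrow> rat" where
  "fermat_quotient p a = (of_nat a ^ (p - 1) - 1) / of_nat p"

(* quotient_of returns the reduced fraction with positive denominator. *)
definition rat_cong :: "rat \<Rightarrow> rat \<Rightarrow> nat \<Rightarrow> bool" where
  "rat_cong a b p \<longleftrightarrow>
     (\<exists>c. coprime (snd (quotient_of c)) (int p) \<and> a - b = of_nat p * c)"

end

(*
  Write chi for the quadratic character modulo 3 and m = (p - 1) / 2.  Expanding
  f_n = sum_k C(n,k) C(2k,k) C(k,n-k) and interchanging the sums, only k <= m matters modulo p,
  because p divides C(2k,k) for m < k < p.  The inner sums
  sum_n (-1)^n C(n,k) C(k,n-k) H_n^(r) are evaluated by a WZ pair: they equal 2 H_k for r = 1 and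
  sum_{i <= k} 3 / (i^2 C(2i,i)) for r = 2.  As C(2k,k) = (-4)^k C(m,k) modulo p, a binomial
  transform turns the remaining sum over k into a sum with powers of 1 - 4 = -3.

  For r = 1 the result is read off, modulo p^2, from sum_i C(p,2i) (-3)^(m-i) = 2^(p-1) chi(p).

  For r = 2 one meets sum_l (-3)^(m-l) / l * sum_{s <= l} 1 / (2s-1).  Up to a factor, these are
  modulo p the odd coefficients of the homogenised finite dilogarithm
  K(x) = sum_{0 < j < p} (x-1)^j (x+1)^(p-j) / j^2 (differentiate twice), so the sum is the
  coefficient of x in K(x) mod x^2 + 3.  There (x-1)/2 is a primitive cube root of unity, which
  gives a character sum of the 1 / j^2; the symmetries j -> p - j and j -> 2j modulo p reduce it
  to sum_j chi(j) / j^2, and the difference equation of the Bernoulli polynomials identifies the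
  latter with B_{p-2}(1/3) / 6 modulo p.
*)

theory Submission
  imports Defs
begin

section \<open>Franel numbers and a WZ pair\<close>

text \<open>The Fermat quotient depends on a power of 3 modulo p^2, so congruences modulo p alone
  cannot produce it. Order one therefore rests on exact identities that are divided by p.

  For order two, the powers of -3 must be tied to a root of unity without leaving the rationals, so
  a square root of -3 is replaced by the residue of x modulo x^2 + 3. The dilogarithm enters at y =
  (x - 1) / (x + 1). It is homogenised by (x + 1)^p, whose derivative vanishes modulo p, so (x^2 -
  1) d/dx acts as 2 y d/dy and lowers 1 / j^2 to 1 / j; one more derivative leaves a geometric sum.
  Differentiation loses the coefficient of x^p, which is found separately.

  On the Bernoulli side, unit steps from a/3 with a = p mod 3 end at p/3, which is 0 modulo p. Hence
  1/3 is reached directly for a = 1, but only through the reflection formula for a = 2.\<close>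

text \<open>
  Extending \<open>1 / z!\<close> by zero to negative \<open>z\<close> makes the shift rule hold for every integer, so the
  hypergeometric identities below need no boundary cases.
\<close>

definition inv_fact :: "int \<Rightarrow> rat" where
  "inv_fact z = (if z < 0 then 0 else 1 / fact (nat z))"

lemma inv_fact_diff_one: "inv_fact (z - 1) = of_int z * inv_fact z"
proof (cases "z > 0")
  case True
  then obtain n where "z = int (Suc n)"
    using gr0_conv_Suc zero_less_imp_eq_int by (metis of_nat_0_less_iff)
  then show ?thesis
    by (simp add: inv_fact_def nat_add_distrib field_simps del: of_nat_Suc) simp
qed (auto simp: inv_fact_def)

lemma inv_fact_eq_times:
  assumes "w = z - 1"
  shows "inv_fact w = of_int z * inv_fact z"
  unfolding assms by (rule inv_fact_diff_one)

text \<open>The k-th summand of (-1)^n f_n without the factor C(2k,k). That factor does not depend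
  on n, so after the sums are interchanged only this kernel meets the weights.\<close>

definition franel_coeff :: "nat \<Rightarrow> nat \<Rightarrow> rat" where
  "franel_coeff k n = (-1) ^ n * of_nat (n choose k) * of_nat (k choose (n - k))"

lemma franel_coeff_eq_0:
  assumes "n < k \<or> 2 * k < n"
  shows "franel_coeff k n = 0"
  using assms by (auto simp: franel_coeff_def binomial_eq_0)

text \<open>\<open>fact k\<close> cancels between the two binomial coefficients, and the reciprocal
  factorials vanish exactly outside k <= n <= 2k. Shifts in n and k then only produce linear
  factors.\<close>

lemma franel_coeff_inv_fact:
  "franel_coeff k n =
     (-1) ^ n * fact n * inv_fact (int n - int k) ^ 2 * inv_fact (2 * int k - int n)"
proof (cases "k \<le> n \<and> n \<le> 2 * k")
  case True
  then have "n - k \<le> k" "k - (n - k) = 2 * k - n"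
    by auto
  with True have "of_nat (n choose k) = (fact n / (fact k * fact (n - k)) :: rat)"
    and "of_nat (k choose (n - k)) = (fact k / (fact (n - k) * fact (2 * k - n)) :: rat)"
    using binomial_fact[of k n, where ?'a = rat] binomial_fact[of "n - k" k, where ?'a = rat]
    by simp_all
  moreover have "nat (int n - int k) = n - k" "nat (2 * int k - int n) = 2 * k - n"
    using True by auto
  ultimately show ?thesis
    using True by (simp add: franel_coeff_def inv_fact_def power2_eq_square)
next
  case False
  then show ?thesis
    using franel_coeff_eq_0[of n k] by (auto simp: inv_fact_def)
qed

text \<open>Both sides equal the sum over k of C(n,k)^2 C(2k,n). One side follows by trinomial
  revision. For the other, expand C(2k,n) by Vandermonde and swap the sums.\<close>

lemma franel_eq_sum_choose_central:
  "franel n = (\<Sum>k\<le>n. (n choose k) * ((2 * k) choose k) * (k choose (n - k)))"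
proof -
  \<comment> \<open>Two trinomial revisions extract C(n,i) twice: C(n,k) C(k,i) = C(n,i) C(n-i,k-i)
    and C(n,k) C(k,n-i) = C(n,i) C(i,n-k). What remains is a Vandermonde convolution with value
    C(n,i).\<close>
  have inner: "(\<Sum>k\<le>n. (n choose k)\<^sup>2 * ((k choose i) * (k choose (n - i)))) = (n choose i) ^ 3"
    if i: "i \<le> n" for i
  proof -
    have "(n choose k)\<^sup>2 * ((k choose i) * (k choose (n - i)))
        = (n choose i)\<^sup>2 * (if i \<le> k then ((n - i) choose (k - i)) * (i choose (n - k)) else 0)"
      if k: "k \<le> n" for k
    proof (cases "i \<le> k \<and> n - i \<le> k")
      case True
      have "(n choose k) * (k choose i) = (n choose i) * ((n - i) choose (k - i))"
        using True k by (intro choose_mult) auto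
      moreover have "(n choose k) * (k choose (n - i)) = (n choose i) * (i choose (n - k))"
      proof -
        have "(n choose k) * (k choose (n - i)) =
            (n choose (n - i)) * ((n - (n - i)) choose (k - (n - i)))"
          using True k by (intro choose_mult) auto
        moreover have "n choose (n - i) = n choose i"
          using i by (simp add: binomial_symmetric[symmetric])
        moreover have "i choose (k - (n - i)) = i choose (n - k)"
        proof -
          have "n - k \<le> i" "i - (n - k) = k - (n - i)"
            using True k i by auto
          then show ?thesis
            using binomial_symmetric[of "n - k" i] by simp
        qed
        ultimately show ?thesis
          using i by simp
      qed
      moreover have "(n choose k)\<^sup>2 * ((k choose i) * (k choose (n - i))) =
          ((n choose k) * (k choose i)) * ((n choose k) * (k choose (n - i)))"
        by (simp add: power2_eq_square)
      ultimately show ?thesis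
        using True by (simp add: power2_eq_square)
    next
      case False
      then show ?thesis
        using i k by (auto simp: binomial_eq_0)
    qed
    then have "(\<Sum>k\<le>n. (n choose k)\<^sup>2 * ((k choose i) * (k choose (n - i))))
        = (n choose i)\<^sup>2 *
          (\<Sum>k\<le>n. if i \<le> k then ((n - i) choose (k - i)) * (i choose (n - k)) else 0)"
      unfolding sum_distrib_left by (intro sum.cong) auto
    also have "(\<Sum>k\<le>n. if i \<le> k then ((n - i) choose (k - i)) * (i choose (n - k)) else 0)
        = (\<Sum>j\<le>n - i. ((n - i) choose j) * (i choose (n - i - j)))"
    proof -
      have "(\<Sum>k\<le>n. if i \<le> k then ((n - i) choose (k - i)) * (i choose (n - k)) else 0)
          = (\<Sum>k=i..n. ((n - i) choose (k - i)) * (i choose (n - k)))"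
        by (rule sum.mono_neutral_cong_right) auto
      also have "\<dots> = (\<Sum>j\<le>n - i. ((n - i) choose j) * (i choose (n - i - j)))"
        using i by (intro sum.reindex_bij_witness[of _ "\<lambda>j. j + i" "\<lambda>k. k - i"]) auto
      finally show ?thesis .
    qed
    also have "\<dots> = n choose i"
      using vandermonde[of "n - i" i "n - i"] i by (simp add: binomial_symmetric[symmetric])
    finally show ?thesis
      by (simp add: power2_eq_square power3_eq_cube)
  qed
  have "(\<Sum>k\<le>n. (n choose k) * ((2 * k) choose k) * (k choose (n - k)))
      = (\<Sum>k\<le>n. (n choose k)\<^sup>2 * ((2 * k) choose n))"
  proof (rule sum.cong)
    fix k assume "k \<in> {..n}"
    then have k: "k \<le> n"
      by simp
    have "((2 * k) choose k) * (k choose (n - k)) = (n choose k) * ((2 * k) choose n)"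
    proof (cases "n \<le> 2 * k")
      case True
      have "2 * k - k = k"
        by simp
      then show ?thesis
        using choose_mult[of k n "2 * k"] True k by (simp add: mult.commute)
    qed (auto simp: binomial_eq_0)
    then show "(n choose k) * ((2 * k) choose k) * (k choose (n - k)) =
        (n choose k)\<^sup>2 * ((2 * k) choose n)"
      by (simp add: power2_eq_square mult.assoc)
  qed simp
  also have "\<dots> = (\<Sum>k\<le>n. \<Sum>i\<le>n. (n choose k)\<^sup>2 * ((k choose i) * (k choose (n - i))))"
    by (simp add: vandermonde mult_2 flip: sum_distrib_left)
  also have "\<dots> = (\<Sum>i\<le>n. \<Sum>k\<le>n. (n choose k)\<^sup>2 * ((k choose i) * (k choose (n - i))))"
    by (rule sum.swap)
  also have "\<dots> = franel n"
    by (simp add: inner franel_def atLeast0AtMost)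
  finally show ?thesis ..
qed

lemma alternating_franel_eq_sum_franel_coeff:
  assumes "n < N"
  shows "(-1) ^ n * of_nat (franel n) =
    (\<Sum>k<N. of_nat ((2 * k) choose k) * franel_coeff k n)"
proof -
  have "(-1) ^ n * of_nat (franel n) =
      (\<Sum>k\<le>n. of_nat ((2 * k) choose k) * franel_coeff k n)"
    by (simp add: franel_eq_sum_choose_central franel_coeff_def sum_distrib_left mult_ac)
  also have "\<dots> = (\<Sum>k<N. of_nat ((2 * k) choose k) * franel_coeff k n)"
    using assms by (intro sum.mono_neutral_left) (auto simp: franel_coeff_eq_0)
  finally show ?thesis .
qed

text \<open>Found by Zeilberger's algorithm, applied to \<open>sum_franel_coeff\<close>.\<close>

definition franel_cert :: "nat \<Rightarrow> nat \<Rightarrow> rat" where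
  "franel_cert k n = (3 - 2 * of_nat n / of_nat (k + 1)) * franel_coeff (k + 1) n"

lemma franel_coeff_Suc_diff:
  "franel_coeff (k + 1) n - franel_coeff k n = franel_cert k (n + 1) - franel_cert k n"
proof -
  define K N :: rat where "K = of_nat k" and "N = of_nat n"
  \<comment> \<open>These have the largest arguments that occur, so every other reciprocal factorial
    is a polynomial multiple of X or Y, and the claim becomes a polynomial identity after clearing k
    + 1.\<close>
  define X Y where "X = inv_fact (int n - int k)" and "Y = inv_fact (2 * int k + 2 - int n)"
  have shifts: "inv_fact (int n - int (k + 1)) = (N - K) * X"
    "inv_fact (2 * int k + 1 - int n) = (2 * K + 2 - N) * Y"
    "inv_fact (2 * int k - int n) = (2 * K + 1 - N) * ((2 * K + 2 - N) * Y)"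
    using inv_fact_eq_times[of "int n - int (k + 1)" "int n - int k"]
      inv_fact_eq_times[of "2 * int k + 1 - int n" "2 * int k + 2 - int n"]
      inv_fact_eq_times[of "2 * int k - int n" "2 * int k + 1 - int n"]
    by (simp_all add: K_def N_def X_def Y_def)
  define C where "C = (-1) ^ n * fact n * X\<^sup>2 * Y"
  have c0: "franel_coeff k n = C * ((2 * K + 1 - N) * (2 * K + 2 - N))"
    unfolding franel_coeff_inv_fact shifts C_def X_def[symmetric] by (simp add: mult_ac)
  have "2 * int (k + 1) - int n = 2 * int k + 2 - int n"
    by simp
  then have c1: "franel_coeff (k + 1) n = C * (N - K)\<^sup>2"
    unfolding franel_coeff_inv_fact shifts C_def Y_def
    by (simp only: power_mult_distrib mult_ac)
  have "2 * int (k + 1) - int (n + 1) = 2 * int k + 1 - int n" "int (n + 1) - int (k + 1) = int n - int k"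
    by simp_all
  then have c2: "franel_coeff (k + 1) (n + 1) = - C * (N + 1) * (2 * K + 2 - N)"
    unfolding franel_coeff_inv_fact C_def by (simp only: shifts X_def[symmetric]) (simp add: N_def)
  define L where "L = K + 1"
  have L: "of_nat (k + 1) = L"
    by (simp add: L_def K_def)
  then have nz: "L \<noteq> 0"
    by (metis of_nat_eq_0_iff add_is_0 zero_neq_one)
  have K: "K = L - 1" and N: "of_nat n = N" "of_nat (n + 1) = N + 1"
    by (simp_all add: L_def N_def)
  show ?thesis
    unfolding franel_cert_def c0 c1 c2 L N K using nz by (simp add: field_simps power2_eq_square)
qed

section \<open>Summation by parts and elementary sums of the kernel\<close>

lemma sum_by_parts:
  fixes G w :: "nat \<Rightarrow> 'a :: comm_ring_1"
  shows "(\<Sum>n<N. (G (n + 1) - G n) * w n) =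
    G N * w N - G 0 * w 0 - (\<Sum>n<N. G (n + 1) * (w (n + 1) - w n))"
  by (induction N) (simp_all add: algebra_simps)

text \<open>For constant w the WZ equation makes the sum independent of k; for other weights,
  summation by parts moves the difference from the certificate to w. The certificate vanishes at N,
  beyond its support n <= 2k + 2, and \<open>w 0 = 0\<close> handles the lower end.\<close>

lemma sum_franel_coeff_Suc:
  assumes "2 * k + 2 < N" and "w 0 = 0"
  shows "(\<Sum>n<N. franel_coeff (k + 1) n * w n) = (\<Sum>n<N. franel_coeff k n * w n)
    - (\<Sum>n<N. franel_cert k (n + 1) * (w (n + 1) - w n))"
proof -
  have "franel_cert k N = 0"
    using assms by (simp add: franel_cert_def franel_coeff_eq_0)
  then have "(\<Sum>n<N. (franel_coeff (k + 1) n - franel_coeff k n) * w n) =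
      - (\<Sum>n<N. franel_cert k (n + 1) * (w (n + 1) - w n))"
    unfolding franel_coeff_Suc_diff sum_by_parts using assms by simp
  then show ?thesis
    by (simp add: left_diff_distrib sum_subtractf)
qed

lemma sum_franel_coeff:
  assumes "2 * k < N"
  shows "(\<Sum>n<N. franel_coeff k n) = 1"
  using assms
proof (induction k)
  case 0
  have "franel_coeff 0 n = (if n = 0 then 1 else 0)" for n
    by (cases n) (auto simp: franel_coeff_def)
  then show ?case
    using 0 by simp
next
  case (Suc k)
  have "(\<Sum>n<N. franel_coeff (k + 1) n - franel_coeff k n) = franel_cert k N - franel_cert k 0"
    unfolding franel_coeff_Suc_diff by (simp add: sum_lessThan_telescope)
  also have "\<dots> = 0"
    using Suc.prems by (simp add: franel_cert_def franel_coeff_eq_0)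
  finally show ?case
    using Suc by (simp add: sum_subtractf)
qed

text \<open>For k > 0 the summand is Gosper summable in n, with the antidifference T of the proof,
  which vanishes at both ends. This removes the 1/n term from the recursion in k for either order of
  harmonic numbers.\<close>

lemma sum_franel_coeff_divide:
  assumes "2 * k < N" and "k > 0"
  shows "(\<Sum>n<N. franel_coeff k n / of_nat n) = 0"
proof -
  define T :: "nat \<Rightarrow> rat" where
    "T n = - (of_nat n - of_nat k)\<^sup>2 * franel_coeff k n / (of_nat n * (of_nat k)\<^sup>2)" for n
  have "franel_coeff k n / of_nat n = T (n + 1) - T n" for n
  proof (cases "n = 0")
    case True
    \<comment> \<open>The left side is 0 because division by 0 yields 0, and so is
      \<open>T 0\<close>. \<open>T 1\<close> vanishes through the kernel or, for k = 1, through the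
      square of n - k.\<close>
    have "franel_coeff k 1 = 0 \<or> k = 1"
      using assms by (cases "k = 1") (auto simp: franel_coeff_eq_0)
    then show ?thesis
      using True assms by (auto simp: T_def)
  next
    case False
    define K M :: rat where "K = of_nat k" and "M = of_nat n"
    define X Y where "X = inv_fact (int n - int k + 1)" and "Y = inv_fact (2 * int k - int n)"
    have shifts: "inv_fact (int n - int k) = (M - K + 1) * X"
      "inv_fact (2 * int k - int (n + 1)) = (2 * K - M) * Y"
      "int (n + 1) - int k = int n - int k + 1"
      using inv_fact_eq_times[of "int n - int k" "int n - int k + 1"]
        inv_fact_eq_times[of "2 * int k - int (n + 1)" "2 * int k - int n"]
      by (simp_all add: K_def M_def X_def Y_def)
    define C where "C = (-1) ^ n * fact n * X\<^sup>2 * Y"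
    have c0: "franel_coeff k n = C * (M - K + 1)\<^sup>2"
      unfolding franel_coeff_inv_fact shifts C_def Y_def[symmetric]
      by (simp add: power_mult_distrib mult_ac)
    have c1: "franel_coeff k (n + 1) = - C * (M + 1) * (2 * K - M)"
      unfolding franel_coeff_inv_fact shifts C_def X_def[symmetric] by (simp add: M_def mult_ac)
    have nz: "M \<noteq> 0" "K \<noteq> 0"
      using assms False by (simp_all add: M_def K_def)
    define L where "L = M + 1"
    have L: "of_nat (n + 1) = L"
      by (simp add: L_def M_def)
    then have "L \<noteq> 0"
      by (metis of_nat_eq_0_iff add_is_0 zero_neq_one)
    define D where "D = C * (L - K)\<^sup>2"
    have D: "franel_coeff k n = D"
      by (simp add: c0 D_def L_def algebra_simps)
    have T0: "T n = - (M - K)\<^sup>2 * D / (M * K\<^sup>2)"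
      unfolding T_def D by (simp add: M_def K_def)
    have T1: "T (n + 1) = D * (2 * K - M) / K\<^sup>2"
      unfolding T_def L c1 K_def[symmetric] L_def[symmetric] D_def
      using \<open>L \<noteq> 0\<close> nz by (simp add: field_simps)
    show ?thesis
      using nz unfolding M_def[symmetric] D T0 T1
      by (simp add: field_simps power2_eq_square)
  qed
  then have "(\<Sum>n<N. franel_coeff k n / of_nat n) = T N - T 0"
    by (simp add: sum_lessThan_telescope)
  also have "\<dots> = 0"
    using assms by (simp add: T_def franel_coeff_eq_0)
  finally show ?thesis .
qed

text \<open>The residue at z = -j of the rational function on the right of
  \<open>sum_beta_summand_divide\<close>, which is therefore a partial fraction expansion.\<close>

definition beta_summand :: "nat \<Rightarrow> nat \<Rightarrow> rat" where
  "beta_summand k j = (-1) ^ j * fact (k + j) * inv_fact (int j) ^ 2 * inv_fact (int k + 1 - int j)"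

text \<open>
  In the recursion in \<open>k\<close> the \<open>z\<close>-dependent factors cancel, leaving a multiple of the summand
  \<open>e\<close>, which telescopes.  Only \<open>z = k + 1\<close> is needed later, but the recursion requires \<open>z\<close> to be
  independent of \<open>k\<close>.
\<close>

lemma sum_beta_summand_divide:
  assumes "z > 0" and "k + 1 < N"
  shows "(\<Sum>j<N. beta_summand k j / (z + of_nat j)) =
    (\<Prod>i=1..k. of_nat i - z) / (\<Prod>i\<le>k+1. z + of_nat i)"
  using assms(2)
proof (induction k)
  case 0
  have z: "beta_summand 0 j = 0" if "j \<ge> 2" for j
    using that by (simp add: beta_summand_def inv_fact_def)
  have "(\<Sum>j<N. beta_summand 0 j / (z + of_nat j)) = (\<Sum>j<2. beta_summand 0 j / (z + of_nat j))"
    using 0 z by (intro sum.mono_neutral_right) auto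
  also have "\<dots> = 1 / z - 1 / (z + 1)"
    by (simp add: numeral_2_eq_2 beta_summand_def inv_fact_def)
  also have "\<dots> = 1 / (z * (z + 1))"
    using assms by (simp add: field_simps)
  finally show ?case
    by simp
next
  case (Suc k)
  define K :: rat where "K = of_nat k + 1"
  have K: "K > 0" "of_nat k = K - 1"
    by (simp_all add: K_def)
  define e where
    "e j = (-1) ^ j * fact (k + j) * inv_fact (int j) ^ 2 * inv_fact (int k + 2 - int j)" for j
  define T where "T j = of_nat j ^ 2 * (of_nat j - (K\<^sup>2 + K + 1)) * e j / (K\<^sup>2 * (K + 1)\<^sup>2)" for j
  have s0: "beta_summand k j = (K + 1 - of_nat j) * e j" for j
    using inv_fact_eq_times[of "int k + 1 - int j" "int k + 2 - int j"]
    by (simp add: beta_summand_def e_def K_def)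
  have s1: "beta_summand (Suc k) j = (K + of_nat j) * e j" for j
  proof -
    have "int (Suc k) + 1 - int j = int k + 2 - int j"
      by simp
    then show ?thesis
      unfolding beta_summand_def e_def by (simp add: K_def add_ac)
  qed
  have e_Suc: "e j = T (j + 1) - T j" for j
  proof -
    define J :: rat where "J = of_nat j"
    define X Y where "X = inv_fact (int j + 1)" and "Y = inv_fact (int k + 2 - int j)"
    define C where "C = (-1) ^ j * fact (k + j) * X\<^sup>2 * Y"
    have x: "inv_fact (int j) = (J + 1) * X" and y: "inv_fact (int k + 2 - int (j + 1)) = (K + 1 - J) * Y"
      using inv_fact_eq_times[of "int j" "int j + 1"]
        inv_fact_eq_times[of "int k + 2 - int (j + 1)" "int k + 2 - int j"]
      by (simp_all add: X_def Y_def J_def K_def)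
    have e0: "e j = C * (J + 1)\<^sup>2"
      unfolding e_def x C_def Y_def by (simp only: power_mult_distrib mult_ac)
    have "int (j + 1) = int j + 1"
      by simp
    then have e1: "e (j + 1) = - C * (K + J) * (K + 1 - J)"
      unfolding e_def y C_def X_def by (simp add: K_def J_def add_ac)
    have T0: "T j = J\<^sup>2 * (J - (K\<^sup>2 + K + 1)) * (C * (J + 1)\<^sup>2) / (K\<^sup>2 * (K + 1)\<^sup>2)"
      unfolding T_def e0 J_def ..
    have T1: "T (j + 1) = (J + 1)\<^sup>2 * (J - (K\<^sup>2 + K)) * (- C * (K + J) * (K + 1 - J)) / (K\<^sup>2 * (K + 1)\<^sup>2)"
      unfolding T_def e1 by (simp add: J_def algebra_simps)
    have nz: "K\<^sup>2 * (K + 1)\<^sup>2 \<noteq> 0"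
      using K by simp
    have "C * (J + 1)\<^sup>2 * (K\<^sup>2 * (K + 1)\<^sup>2) = (J + 1)\<^sup>2 * (J - (K\<^sup>2 + K)) * (- C * (K + J) * (K + 1 - J))
        - J\<^sup>2 * (J - (K\<^sup>2 + K + 1)) * (C * (J + 1)\<^sup>2)"
      by (simp add: algebra_simps power2_eq_square)
    then show ?thesis
      unfolding T0 T1 e0 diff_divide_distrib[symmetric] by (rule nonzero_eq_divide_eq[OF nz, THEN iffD2])
  qed
  have "(\<Sum>j<N. e j) = T N - T 0"
    by (subst e_Suc) (simp add: sum_lessThan_telescope)
  also have "\<dots> = 0"
    using Suc.prems by (simp add: T_def e_def inv_fact_def)
  finally have sum_e: "(\<Sum>j<N. e j) = 0" .
  \<comment> \<open>Since (z + K + 1) (K + j) - (K - z) (K + 1 - j) = (2 K + 1) (z + j), the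
    denominator z + j cancels in the difference.\<close>
  have "(z + K + 1) * (beta_summand (Suc k) j / (z + of_nat j))
      = (K - z) * (beta_summand k j / (z + of_nat j)) + (2 * K + 1) * e j" for j
  proof -
    have "z + of_nat j \<noteq> 0"
      using assms by (metis add_pos_nonneg of_nat_0_le_iff less_irrefl)
    moreover have "(z + K + 1) * ((K + of_nat j) * e j)
        = (K - z) * ((K + 1 - of_nat j) * e j) + (2 * K + 1) * e j * (z + of_nat j)"
      by (simp add: algebra_simps)
    ultimately show ?thesis
      unfolding s0 s1 times_divide_eq_right by (simp only: add_divide_distrib) simp
  qed
  then have "(z + K + 1) * (\<Sum>j<N. beta_summand (Suc k) j / (z + of_nat j))
      = (\<Sum>j<N. (K - z) * (beta_summand k j / (z + of_nat j)) + (2 * K + 1) * e j)"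
    unfolding sum_distrib_left by (intro sum.cong) auto
  also have "\<dots> = (K - z) * (\<Sum>j<N. beta_summand k j / (z + of_nat j)) + (2 * K + 1) * (\<Sum>j<N. e j)"
    by (simp only: sum.distrib sum_distrib_left)
  finally have "(z + K + 1) * (\<Sum>j<N. beta_summand (Suc k) j / (z + of_nat j))
      = (K - z) * (\<Sum>j<N. beta_summand k j / (z + of_nat j))"
    using sum_e by simp
  moreover have "z + K + 1 \<noteq> 0"
    using assms K by simp
  ultimately have "(\<Sum>j<N. beta_summand (Suc k) j / (z + of_nat j))
      = (K - z) * (\<Sum>j<N. beta_summand k j / (z + of_nat j)) / (z + K + 1)"
    by (metis nonzero_mult_div_cancel_left)
  also have "\<dots> = (K - z) * ((\<Prod>i=1..k. of_nat i - z) / (\<Prod>i\<le>k+1. z + of_nat i)) / (z + K + 1)"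
    using Suc by simp
  also have "\<dots> = (\<Prod>i=1..Suc k. of_nat i - z) / (\<Prod>i\<le>Suc k+1. z + of_nat i)"
  proof -
    have "(\<Prod>i=1..Suc k. of_nat i - z) = (K - z) * (\<Prod>i=1..k. of_nat i - z)"
      by (simp add: K_def)
    moreover have "(\<Prod>i\<le>Suc k+1. z + of_nat i) = (\<Prod>i\<le>k+1. z + of_nat i) * (z + K + 1)"
      by (simp add: K_def add_ac)
    ultimately show ?thesis
      by (simp only: times_divide_eq_right divide_divide_eq_left)
  qed
  finally show ?case .
qed

text \<open>Put n = k + j. One factor n of the factorial cancels, and the partial fraction expansion
  with index k - 1 is evaluated at z = k: its numerator is (-1)^(k-1) (k-1)!, its denominator (2k)!
  / (k-1)!. This is how a central binomial coefficient enters a denominator.\<close>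

lemma sum_franel_coeff_divide_square:
  assumes "2 * k < N" and "k > 0"
  shows "(\<Sum>n<N. franel_coeff k n / of_nat n ^ 2) =
    - 1 / (of_nat k ^ 2 * of_nat ((2 * k) choose k))"
proof -
  obtain l where k: "k = Suc l"
    using assms by (cases k) auto
  have "(\<Sum>n<N. franel_coeff k n / of_nat n ^ 2) = (\<Sum>n=k..<N. franel_coeff k n / of_nat n ^ 2)"
    by (rule sum.mono_neutral_right) (auto simp: franel_coeff_eq_0)
  also have "\<dots> = (\<Sum>j<N-k. franel_coeff k (k + j) / of_nat (k + j) ^ 2)"
    using assms by (intro sum.reindex_bij_witness[of _ "\<lambda>j. k + j" "\<lambda>n. n - k"]) auto
  also have "\<dots> = (\<Sum>j<N-k. (-1) ^ k * (beta_summand l j / (of_nat k + of_nat j)))"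
  proof (rule sum.cong)
    fix j
    have "fact (k + j) = (of_nat (k + j) * fact (l + j) :: rat)"
      by (simp add: k)
    moreover have "2 * int k - int (k + j) = int l + 1 - int j" "int (k + j) - int k = int j"
      by (simp_all add: k)
    ultimately have "franel_coeff k (k + j) = of_nat (k + j) * ((-1) ^ k * beta_summand l j)"
      unfolding franel_coeff_inv_fact beta_summand_def by (simp only: power_add mult_ac)
    moreover have "of_nat (k + j) \<noteq> (0 :: rat)"
      using assms by (simp only: of_nat_eq_0_iff)
    ultimately show "franel_coeff k (k + j) / of_nat (k + j) ^ 2 =
        (-1) ^ k * (beta_summand l j / (of_nat k + of_nat j))"
      unfolding of_nat_add[symmetric] by (simp add: power2_eq_square del: of_nat_add)
  qed simp
  also have "\<dots> = (-1) ^ k * ((\<Prod>i=1..l. of_nat i - of_nat k) / (\<Prod>i\<le>l+1. of_nat k + of_nat i))"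
    using assms k by (subst sum_distrib_left[symmetric], subst sum_beta_summand_divide) auto
  also have "(\<Prod>i=1..l. of_nat i - of_nat k) = ((-1) ^ l * fact l :: rat)"
  proof -
    have "(\<Prod>i=1..l. of_nat i - of_nat k :: rat) = (\<Prod>i=1..l. - of_nat (k - i))"
      using k by (intro prod.cong) (auto simp: of_nat_diff)
    also have "\<dots> = (-1) ^ l * (\<Prod>i=1..l. of_nat (k - i))"
      by (simp add: prod_uminus)
    also have "(\<Prod>i=1..l. of_nat (k - i) :: rat) = (\<Prod>i=1..l. of_nat i)"
      using k by (intro prod.reindex_bij_witness[of _ "\<lambda>i. k - i" "\<lambda>i. k - i"]) auto
    finally show ?thesis
      by (simp add: fact_prod)
  qed
  also have "(\<Prod>i\<le>l+1. of_nat k + of_nat i :: rat) = fact (2 * k) / fact l"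
  proof -
    have prod: "(\<Prod>i\<le>n. of_nat k + of_nat i :: rat) = fact (k + n) / fact l" for n
    proof (induction n)
      case 0
      show ?case
        by (simp add: k)
    next
      case (Suc n)
      have "fact (k + Suc n) = (of_nat k + of_nat (Suc n)) * (fact (k + n) :: rat)"
        by simp
      then show ?case
        using Suc.IH by simp
    qed
    have "l + 1 = k"
      by (simp add: k)
    then show ?thesis
      unfolding mult_2 by (simp only: prod)
  qed
  also have "(-1) ^ k * ((-1) ^ l * fact l / (fact (2 * k) / fact l))
      = - 1 / (of_nat k ^ 2 * of_nat ((2 * k) choose k) :: rat)"
  proof -
    have "of_nat ((2 * k) choose k) = (fact (2 * k) / (fact k * fact k) :: rat)"
      using binomial_fact[of k "2 * k", where ?'a = rat] by simp
    moreover have "fact k = (of_nat k * fact l :: rat)"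
      by (simp add: k)
    moreover have "(-1) ^ k * (-1) ^ l = (- 1 :: rat)"
      by (simp add: k flip: power_mult_distrib)
    ultimately show ?thesis
      using assms by (simp add: field_simps power2_eq_square)
  qed
  finally show ?thesis .
qed

section \<open>Sums of the kernel against harmonic numbers\<close>

lemma gen_harm_Suc: "gen_harm r (n + 1) - gen_harm r n = 1 / of_nat (n + 1) ^ r"
  by (simp add: gen_harm_def)

lemma sum_shift_neutral:
  fixes f :: "nat \<Rightarrow> rat"
  assumes "f 0 = 0" and "f N = 0"
  shows "(\<Sum>n<N. f (n + 1)) = (\<Sum>n<N. f n)"
  using assms sum.lessThan_Suc_shift[of f N] by simp

text \<open>\<open>sum_franel_coeff_Suc\<close> at w = \<open>gen_harm r\<close>, whose increment is
  1 / (n + 1)^r. The two terms of the certificate factor 3 - 2 n / (k + 1) give the inverse powers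
  of order r and r - 1.\<close>

lemma sum_franel_coeff_gen_harm_Suc:
  assumes "2 * k + 2 < N" and "r > 0"
  shows "(\<Sum>n<N. franel_coeff (k + 1) n * gen_harm r n) = (\<Sum>n<N. franel_coeff k n * gen_harm r n)
    - 3 * (\<Sum>n<N. franel_coeff (k + 1) n / of_nat n ^ r)
    + 2 / of_nat (k + 1) * (\<Sum>n<N. franel_coeff (k + 1) n / of_nat n ^ (r - 1))"
proof -
  have "(\<Sum>n<N. franel_coeff (k + 1) n * gen_harm r n) = (\<Sum>n<N. franel_coeff k n * gen_harm r n)
    - (\<Sum>n<N. franel_cert k (n + 1) / of_nat (n + 1) ^ r)"
    using assms sum_franel_coeff_Suc[of k N "gen_harm r"]
    unfolding gen_harm_Suc by (simp add: gen_harm_def)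
  also have "(\<Sum>n<N. franel_cert k (n + 1) / of_nat (n + 1) ^ r) =
      (\<Sum>n<N. franel_cert k n / of_nat n ^ r)"
    using assms by (intro sum_shift_neutral) (auto simp: franel_cert_def franel_coeff_eq_0)
  also have "\<dots> = (\<Sum>n<N. 3 * (franel_coeff (k + 1) n / of_nat n ^ r) -
      2 / of_nat (k + 1) * (franel_coeff (k + 1) n / of_nat n ^ (r - 1)))"
  proof (rule sum.cong)
    fix n
    obtain s where r: "r = Suc s"
      using assms by (cases r) auto
    show "franel_cert k n / of_nat n ^ r = 3 * (franel_coeff (k + 1) n / of_nat n ^ r) -
        2 / of_nat (k + 1) * (franel_coeff (k + 1) n / of_nat n ^ (r - 1))"
      by (cases "n = 0") (simp_all add: franel_cert_def franel_coeff_eq_0 r left_diff_distrib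
          diff_divide_distrib)
  qed simp
  finally show ?thesis
    by (simp add: sum_subtractf sum_distrib_left)
qed

lemma sum_franel_coeff_harm:
  assumes "2 * k < N"
  shows "(\<Sum>n<N. franel_coeff k n * gen_harm 1 n) = 2 * gen_harm 1 k"
  using assms
proof (induction k)
  case 0
  have "franel_coeff 0 n * gen_harm 1 n = 0" for n
    by (cases n) (auto simp: franel_coeff_def gen_harm_def)
  then show ?case
    by (subst sum.neutral) (auto simp: gen_harm_def)
next
  case (Suc k)
  then show ?case
    using sum_franel_coeff_gen_harm_Suc[of k N 1] sum_franel_coeff_divide[of "k + 1" N]
      sum_franel_coeff[of "k + 1" N] gen_harm_Suc[of 1 k]
    by simp
qed

text \<open>Partial sums of the Apery-like series with terms 3 / (i^2 C(2i,i)), whose value is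
  zeta(2).\<close>

definition apery_partial_sum :: "nat \<Rightarrow> rat" where
  "apery_partial_sum k = (\<Sum>i=1..k. 3 / (of_nat i ^ 2 * of_nat ((2 * i) choose i)))"

lemma sum_franel_coeff_harm_square:
  assumes "2 * k < N"
  shows "(\<Sum>n<N. franel_coeff k n * gen_harm 2 n) = apery_partial_sum k"
  using assms
proof (induction k)
  case 0
  have "franel_coeff 0 n * gen_harm 2 n = 0" for n
    by (cases n) (auto simp: franel_coeff_def gen_harm_def)
  then show ?case
    by (subst sum.neutral) (auto simp: apery_partial_sum_def)
next
  case (Suc k)
  have "(\<Sum>n<N. franel_coeff (k + 1) n * gen_harm 2 n) = apery_partial_sum k
      - 3 * (- 1 / (of_nat (k + 1) ^ 2 * of_nat ((2 * (k + 1)) choose (k + 1))))"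
    using Suc sum_franel_coeff_gen_harm_Suc[of k N 2] sum_franel_coeff_divide[of "k + 1" N]
      sum_franel_coeff_divide_square[of "k + 1" N]
    by (simp del: binomial_Suc_Suc)
  also have "\<dots> = apery_partial_sum (k + 1)"
    by (simp add: apery_partial_sum_def del: binomial_Suc_Suc)
  finally show ?case
    by simp
qed

lemma sum_alternating_franel:
  "(\<Sum>n<N. (-1) ^ n * of_nat (franel n) * w n) =
    (\<Sum>k<N. of_nat ((2 * k) choose k) * (\<Sum>n<N. franel_coeff k n * w n))"
proof -
  have "(\<Sum>n<N. (-1) ^ n * of_nat (franel n) * w n) =
      (\<Sum>n<N. \<Sum>k<N. of_nat ((2 * k) choose k) * (franel_coeff k n * w n))"
    by (intro sum.cong) (auto simp: alternating_franel_eq_sum_franel_coeff[of _ N] sum_distrib_right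
        mult.assoc)
  also have "\<dots> = (\<Sum>k<N. of_nat ((2 * k) choose k) * (\<Sum>n<N. franel_coeff k n * w n))"
    by (subst sum.swap) (simp add: sum_distrib_left)
  finally show ?thesis .
qed

section \<open>Congruences between rationals modulo a prime\<close>

locale prime_modulus =
  fixes p :: nat
  assumes prime: "prime p"
begin

definition p_integral :: "rat \<Rightarrow> bool" where
  "p_integral x \<longleftrightarrow> coprime (snd (quotient_of x)) (int p)"

definition cong_p :: "rat \<Rightarrow> rat \<Rightarrow> bool" (infix "\<simeq>" 50) where
  "a \<simeq> b \<longleftrightarrow> rat_cong a b p"

lemma p_gt_0: "p > 0"
  using prime by (rule prime_gt_0_nat)

text \<open>The reduced denominator divides every other denominator of the same number.\<close>

lemma p_integral_divide:
  assumes "\<not> int p dvd b"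
  shows "p_integral (of_int a / of_int b)"
proof -
  obtain c d where q: "quotient_of (of_int a / of_int b) = (c, d)"
    by force
  then have "d > 0" and cd: "coprime c d" and "of_int a / of_int b = (of_int c / of_int d :: rat)"
    by (simp_all add: quotient_of_denom_pos quotient_of_coprime quotient_of_div)
  moreover have "b \<noteq> 0"
    using assms by auto
  ultimately have "of_int (a * d) = (of_int (c * b) :: rat)"
    by (simp add: field_simps)
  then have "a * d = c * b"
    by linarith
  then have "d dvd c * b"
    by (metis dvd_triv_right)
  then have "d dvd b"
    using cd by (simp add: coprime_commute coprime_dvd_mult_right_iff)
  then have "\<not> int p dvd d"
    using assms dvd_trans by blast
  then have "coprime d (int p)"
    using prime_imp_coprime[of "int p" d] prime by (simp add: coprime_commute)
  then show ?thesis
    by (simp add: p_integral_def q)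
qed

lemma p_integralE:
  assumes "p_integral x"
  obtains a b where "\<not> int p dvd b" and "x = of_int a / of_int b"
proof -
  obtain c d where q: "quotient_of x = (c, d)"
    by force
  then have "coprime d (int p)"
    using assms by (simp add: p_integral_def)
  moreover have "\<not> is_unit (int p)"
    using prime by auto
  ultimately have "\<not> int p dvd d"
    using coprime_common_divisor dvd_refl by blast
  then show ?thesis
    using that quotient_of_div[OF q] by blast
qed

lemma p_integral_of_int [simp]: "p_integral (of_int a)"
  using p_integral_divide[of 1 a] prime_gt_1_nat[OF prime] by simp

lemma p_integral_of_nat [simp]: "p_integral (of_nat n)"
  using p_integral_of_int[of "int n"] by simp

lemma p_integral_numeral [simp]: "p_integral (numeral n)"
  using p_integral_of_nat[of "numeral n"] by simp

lemma p_integral_0 [simp]: "p_integral 0" and p_integral_1 [simp]: "p_integral 1"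
  using p_integral_of_nat[of 0] p_integral_of_nat[of 1] by simp_all

lemma p_integral_mult [simp]:
  assumes "p_integral x" and "p_integral y"
  shows "p_integral (x * y)"
proof -
  obtain a b where x: "\<not> int p dvd b" "x = of_int a / of_int b"
    using assms(1) by (rule p_integralE)
  obtain c d where y: "\<not> int p dvd d" "y = of_int c / of_int d"
    using assms(2) by (rule p_integralE)
  have "\<not> int p dvd b * d"
    using x y prime by (simp add: prime_dvd_mult_iff)
  then show ?thesis
    using p_integral_divide[of "b * d" "a * c"] x y by simp
qed

lemma p_integral_add [simp]:
  assumes "p_integral x" and "p_integral y"
  shows "p_integral (x + y)"
proof -
  obtain a b where x: "\<not> int p dvd b" "x = of_int a / of_int b"
    using assms(1) by (rule p_integralE)
  obtain c d where y: "\<not> int p dvd d" "y = of_int c / of_int d"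
    using assms(2) by (rule p_integralE)
  have "\<not> int p dvd b * d"
    using x y prime by (simp add: prime_dvd_mult_iff)
  moreover have "b \<noteq> 0" "d \<noteq> 0"
    using x y by auto
  ultimately show ?thesis
    using p_integral_divide[of "b * d" "a * d + c * b"] x y by (simp add: add_frac_eq)
qed

lemma p_integral_minus [simp]: "p_integral x \<Longrightarrow> p_integral (- x)"
  using p_integral_mult[OF p_integral_of_int[of "- 1"], of x] by simp

lemma p_integral_diff [simp]: "p_integral x \<Longrightarrow> p_integral y \<Longrightarrow> p_integral (x - y)"
  using p_integral_add[of x "- y"] by simp

lemma p_integral_sum [simp]: "(\<And>i. i \<in> A \<Longrightarrow> p_integral (f i)) \<Longrightarrow> p_integral (sum f A)"
  by (induction A rule: infinite_finite_induct) auto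

lemma p_integral_power [simp]: "p_integral x \<Longrightarrow> p_integral (x ^ n)"
  by (induction n) auto

lemma p_integral_divide_of_nat:
  assumes "p_integral x" and "\<not> p dvd n"
  shows "p_integral (x / of_nat n)"
  using p_integral_mult[OF assms(1) p_integral_divide[of "int n" 1]] assms(2) by simp

text \<open>The witness can only be (a - b) / p. In this form the rules for congruences become
  closure properties of the p-integral numbers.\<close>

lemma cong_p_iff: "a \<simeq> b \<longleftrightarrow> p_integral ((a - b) / of_nat p)"
proof -
  have "a - b = of_nat p * c \<longleftrightarrow> (a - b) / of_nat p = c" for c :: rat
    using p_gt_0 by (auto simp: field_simps)
  then show ?thesis
    by (auto simp: cong_p_def rat_cong_def p_integral_def)
qed

lemma cong_p_mult_p: "p_integral c \<Longrightarrow> a - b = of_nat p * c \<Longrightarrow> a \<simeq> b"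
  by (auto simp: cong_p_def rat_cong_def p_integral_def)

lemma cong_p_refl [simp, intro]: "a \<simeq> a"
  by (simp add: cong_p_iff)

lemma cong_p_sym: "a \<simeq> b \<Longrightarrow> b \<simeq> a"
  using p_integral_minus[of "(a - b) / of_nat p"] by (simp add: cong_p_iff minus_divide_left)

lemma cong_p_trans [trans]: "a \<simeq> b \<Longrightarrow> b \<simeq> c \<Longrightarrow> a \<simeq> c"
  using p_integral_add[of "(a - b) / of_nat p" "(b - c) / of_nat p"]
  by (simp add: cong_p_iff flip: add_divide_distrib)

lemma cong_p_add: "a \<simeq> b \<Longrightarrow> c \<simeq> d \<Longrightarrow> a + c \<simeq> b + d"
  using p_integral_add[of "(a - b) / of_nat p" "(c - d) / of_nat p"]
  by (simp add: cong_p_iff algebra_simps flip: add_divide_distrib)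

lemma cong_p_minus: "a \<simeq> b \<Longrightarrow> - a \<simeq> - b"
  using p_integral_minus[of "(a - b) / of_nat p"] by (simp add: cong_p_iff minus_divide_left)

lemma cong_p_diff: "a \<simeq> b \<Longrightarrow> c \<simeq> d \<Longrightarrow> a - c \<simeq> b - d"
  using cong_p_add[OF _ cong_p_minus, of a b c d] by simp

lemma cong_p_scale: "p_integral c \<Longrightarrow> a \<simeq> b \<Longrightarrow> c * a \<simeq> c * b"
  using p_integral_mult[of c "(a - b) / of_nat p"] by (simp add: cong_p_iff algebra_simps)

text \<open>a c - b d = a (c - d) + (a - b) d, hence p-integrality is asked of a and d.\<close>

lemma cong_p_mult:
  assumes "a \<simeq> b" "c \<simeq> d" "p_integral a" "p_integral d"
  shows "a * c \<simeq> b * d"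
proof -
  have "a * c \<simeq> a * d"
    using assms by (intro cong_p_scale)
  also have "a * d \<simeq> b * d"
    using assms cong_p_scale[of d a b] by (simp add: mult.commute)
  finally show ?thesis .
qed

lemma cong_p_sum: "(\<And>i. i \<in> A \<Longrightarrow> f i \<simeq> g i) \<Longrightarrow> sum f A \<simeq> sum g A"
  by (induction A rule: infinite_finite_induct) (auto intro: cong_p_add)

lemma cong_p_integral: "a \<simeq> b \<Longrightarrow> p_integral b \<Longrightarrow> p_integral a"
  using p_integral_add[OF p_integral_mult[OF p_integral_of_nat[of p]], of "(a - b) / of_nat p" b] p_gt_0
  by (simp add: cong_p_iff)

lemma cong_p_power: "a \<simeq> b \<Longrightarrow> p_integral a \<Longrightarrow> a ^ n \<simeq> b ^ n"
  using cong_p_integral[OF cong_p_sym] by (induction n) (auto intro!: cong_p_mult)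

lemma cong_p_cancel:
  assumes "of_nat n * a \<simeq> of_nat n * b" and "\<not> p dvd n"
  shows "a \<simeq> b"
proof -
  have "n \<noteq> 0"
    using assms(2) by (metis dvd_0_right)
  then show ?thesis
    using cong_p_scale[OF p_integral_divide_of_nat[OF p_integral_1 assms(2)] assms(1)] by simp
qed

lemma cong_p_inverse:
  assumes "a \<simeq> b" "p_integral (1 / a)" "p_integral (1 / b)" "a \<noteq> 0" "b \<noteq> 0"
  shows "1 / a \<simeq> 1 / b"
proof -
  have "(1 / a) * (1 / b) * b \<simeq> (1 / a) * (1 / b) * a"
    by (rule cong_p_scale[OF p_integral_mult[OF assms(2,3)] cong_p_sym[OF assms(1)]])
  then show ?thesis
    using assms by simp
qed

lemma cong_p_of_int: "[a = b] (mod int p) \<Longrightarrow> of_int a \<simeq> of_int b"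
proof -
  assume "[a = b] (mod int p)"
  then obtain c where "a - b = int p * c"
    by (auto simp: cong_iff_dvd_diff)
  then have "of_int a - of_int b = (of_nat p * of_int c :: rat)"
    by (metis of_int_diff of_int_mult of_int_of_nat_eq)
  then show ?thesis
    by (rule cong_p_mult_p[rotated]) simp
qed

lemma cong_p_0_if_dvd: "p dvd n \<Longrightarrow> of_nat n \<simeq> 0"
  using cong_p_of_int[of "int n" 0] by (simp add: cong_0_iff)

lemma cong_p_self: "of_nat p \<simeq> 0"
  by (simp add: cong_p_0_if_dvd)

lemma not_dvd_less: "0 < n \<Longrightarrow> n < p \<Longrightarrow> \<not> p dvd n"
  by (auto dest: dvd_imp_le)

lemma p_integral_inverse: "0 < n \<Longrightarrow> n < p \<Longrightarrow> p_integral (1 / of_nat n)"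
  by (simp add: p_integral_divide_of_nat not_dvd_less)

section \<open>Powers, binomial coefficients and reflected inverses modulo p\<close>

lemma fermat_cong_p:
  assumes "\<not> p dvd n"
  shows "of_nat n ^ (p - 1) \<simeq> 1"
proof -
  have "[int n ^ (p - 1) = 1] (mod int p)"
    using fermat_theorem[OF prime assms] by (metis cong_int_iff of_nat_1 of_nat_power)
  from cong_p_of_int[OF this] show ?thesis
    by simp
qed

text \<open>By Pascal's rule neighbouring entries add up to an entry of row p, which p divides, so
  the signs alternate from C(p-1,0) = 1 on.\<close>

lemma binomial_prime_minus_one:
  assumes "k < p"
  shows "of_nat ((p - 1) choose k) \<simeq> (-1) ^ k"
  using assms
proof (induction k)
  case (Suc k)
  have "((p - 1) choose k) + ((p - 1) choose Suc k) = p choose Suc k"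
    using binomial_Suc_Suc[of "p - 1" k] p_gt_0 by simp
  moreover have "p dvd (p choose Suc k)"
    using Suc.prems prime by (intro dvd_choose_prime) auto
  ultimately have "of_nat (((p - 1) choose k) + ((p - 1) choose Suc k)) \<simeq> 0"
    by (simp only: cong_p_0_if_dvd)
  then have "of_nat ((p - 1) choose k) + of_nat ((p - 1) choose Suc k) \<simeq> 0"
    by simp
  from cong_p_diff[OF this Suc.IH] show ?case
    using Suc.prems by simp
qed simp

text \<open>C(p,k) / p = C(p-1,k-1) / k. Dividing an exact identity between binomial sums by p thus
  yields a congruence between harmonic sums.\<close>

lemma binomial_prime_divide:
  assumes "0 < k" and "k < p"
  shows "of_nat (p choose k) / of_nat p \<simeq> - ((-1) ^ k / of_nat k)"
proof -
  obtain l where k: "k = Suc l"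
    using assms by (cases k) auto
  have "k * (p choose k) = p * ((p - 1) choose l)"
    using Suc_times_binomial_eq[of "p - 1" l] p_gt_0 k by (simp add: mult.commute)
  then have "of_nat (k * (p choose k)) = (of_nat (p * ((p - 1) choose l)) :: rat)"
    by simp
  then have "of_nat (p choose k) / of_nat p = 1 / of_nat k * (of_nat ((p - 1) choose l) :: rat)"
    using assms p_gt_0 by (simp add: field_simps)
  also have "\<dots> \<simeq> 1 / of_nat k * (-1) ^ l"
    using assms k by (intro cong_p_scale p_integral_inverse binomial_prime_minus_one) auto
  finally show ?thesis
    by (simp add: k)
qed

lemma cong_p_inverse_reflect:
  assumes "0 < i" "i < p"
  shows "1 / of_nat (p - i) \<simeq> - 1 / of_nat i"
proof -
  have "- of_nat i \<noteq> (0 :: rat)" "of_nat (p - i) \<noteq> (0 :: rat)"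
    using assms by simp_all
  moreover have "p_integral (1 / - of_nat i)"
    using p_integral_minus[OF p_integral_inverse[OF assms]] by simp
  moreover have "of_nat (p - i) \<simeq> - of_nat i"
    using cong_p_diff[OF cong_p_self cong_p_refl[of "of_nat i"]] assms by (simp add: of_nat_diff)
  ultimately have "1 / of_nat (p - i) \<simeq> 1 / - of_nat i"
    using assms by (intro cong_p_inverse p_integral_inverse) auto
  then show ?thesis
    by simp
qed

lemma cong_p_inverse_square_reflect:
  assumes "0 < i" "i < p"
  shows "1 / of_nat (p - i) ^ 2 \<simeq> 1 / of_nat i ^ 2"
proof -
  have "p_integral (- 1 / of_nat i)"
    using p_integral_minus[OF p_integral_inverse[OF assms]] by simp
  then have "(1 / of_nat (p - i)) ^ 2 \<simeq> (- 1 / of_nat i) ^ 2"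
    using cong_p_inverse_reflect[OF assms] cong_p_integral by (intro cong_p_power) auto
  then show ?thesis
    by (simp add: power_divide)
qed

lemma sum_reflect: "(\<Sum>i=1..<p. f (p - i)) = (\<Sum>i=1..<p. f i)"
  by (rule sum.reindex_bij_witness[of _ "\<lambda>i. p - i" "\<lambda>i. p - i"]) auto

end

section \<open>Reduction to sums of powers of -3\<close>

lemma sum_binomial_Suc:
  fixes f :: "nat \<Rightarrow> 'a :: comm_ring_1"
  shows "(\<Sum>k\<le>Suc m. of_nat (Suc m choose k) * f k) =
    (\<Sum>k\<le>m. of_nat (m choose k) * (f k + f (k + 1)))"
proof -
  have "(\<Sum>k\<le>Suc m. of_nat (Suc m choose k) * f k) =
      f 0 + (\<Sum>k\<le>m. of_nat (Suc m choose Suc k) * f (Suc k))"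
    by (subst sum.atMost_Suc_shift) simp
  also have "(\<Sum>k\<le>m. of_nat (Suc m choose Suc k) * f (Suc k)) =
      (\<Sum>k\<le>m. of_nat (m choose k) * f (Suc k)) + (\<Sum>k\<le>m. of_nat (m choose Suc k) * f (Suc k))"
    by (simp add: sum.distrib ring_distribs)
  also have "f 0 + \<dots> = (\<Sum>k\<le>m. of_nat (m choose k) * f (Suc k)) +
      (\<Sum>k\<le>Suc m. of_nat (m choose k) * f k)"
    by (simp add: sum.atMost_Suc_shift flip: sum.atMost_Suc)
  also have "\<dots> = (\<Sum>k\<le>m. of_nat (m choose k) * (f k + f (k + 1)))"
    by (simp add: sum.distrib ring_distribs binomial_eq_0)
  finally show ?thesis .
qed

text \<open>By Pascal's rule, passing from m to m + 1 multiplies the left side by 1 + x and adds the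
  sum of C(m,k) x^(k+1) a_(k+1). Unrolling this recursion gives the powers of 1 + x.\<close>

lemma sum_binomial_partial_sums:
  fixes a :: "nat \<Rightarrow> 'a :: comm_ring_1"
  shows "(\<Sum>k\<le>m. of_nat (m choose k) * (x ^ k * (\<Sum>i=1..k. a i))) =
    (\<Sum>l=1..m. (1 + x) ^ (m - l) * (\<Sum>k<l. of_nat ((l - 1) choose k) * x ^ (k + 1) * a (k + 1)))"
proof (induction m)
  case (Suc m)
  have "(\<Sum>k\<le>Suc m. of_nat (Suc m choose k) * (x ^ k * (\<Sum>i=1..k. a i))) =
      (\<Sum>k\<le>m. (1 + x) * (of_nat (m choose k) * (x ^ k * (\<Sum>i=1..k. a i))) +
        of_nat (m choose k) * x ^ (k + 1) * a (k + 1))"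
    unfolding sum_binomial_Suc by (intro sum.cong) (simp_all add: algebra_simps)
  also have "\<dots> = (1 + x) * (\<Sum>k\<le>m. of_nat (m choose k) * (x ^ k * (\<Sum>i=1..k. a i))) +
      (\<Sum>k<Suc m. of_nat (m choose k) * x ^ (k + 1) * a (k + 1))"
    by (simp only: sum.distrib sum_distrib_left lessThan_Suc_atMost)
  also have "(1 + x) * (\<Sum>k\<le>m. of_nat (m choose k) * (x ^ k * (\<Sum>i=1..k. a i))) =
      (\<Sum>l=1..m. (1 + x) ^ (Suc m - l) *
        (\<Sum>k<l. of_nat ((l - 1) choose k) * x ^ (k + 1) * a (k + 1)))"
    unfolding Suc.IH sum_distrib_left[of "1 + x"]
    by (intro sum.cong) (auto simp: Suc_diff_le mult.assoc)
  finally show ?case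
    by simp
qed simp

lemma binomial_times_inverse_Suc:
  assumes "k < l"
  shows "of_nat ((l - 1) choose k) / of_nat (k + 1) = (of_nat (l choose (k + 1)) / of_nat l :: rat)"
proof -
  have "Suc k * (l choose Suc k) = l * ((l - 1) choose k)"
    using Suc_times_binomial_eq[of "l - 1" k] assms by (simp add: mult.commute)
  then have "of_nat (Suc k) * of_nat (l choose Suc k) = (of_nat l * of_nat ((l - 1) choose k) :: rat)"
    by (metis of_nat_mult)
  then show ?thesis
    using assms by (simp add: field_simps del: of_nat_Suc)
qed

lemma sum_binomial_quotient:
  assumes "l \<le> M"
  shows "(\<Sum>i\<le>l. of_nat (l choose i) / of_nat (M choose i)) =
    (of_nat (M + 1) / of_nat (M + 1 - l) :: rat)"
proof -
  define q where "q i = (of_nat (l choose i) / of_nat (M choose i) :: rat)" for i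
  \<comment> \<open>An antidifference of q, fitted to the ratio q (i + 1) / q i = (l - i) / (M -
    i).\<close>
  define T where "T i = - of_nat (M + 1 - i) / of_nat (M + 1 - l) * q i" for i
  have step: "q i = T (Suc i) - T i" if "i \<le> l" for i
  proof (cases "i = l")
    case True
    \<comment> \<open>The case i = l stands apart because M - i may be 0 there; q (l + 1) is 0
      through its numerator.\<close>
    have "of_nat (M + 1 - l) \<noteq> (0 :: rat)"
      using assms by (simp only: of_nat_eq_0_iff)
    then show ?thesis
      using True by (simp add: T_def q_def binomial_eq_0 del: of_nat_diff)
  next
    case False
    then have i: "i < l"
      using that by simp
    have absorb: "of_nat (Suc i) * of_nat (n choose Suc i) = (of_nat (n - i) * of_nat (n choose i) :: rat)" for n
      using binomial_absorb_comp[of n i] binomial_absorption[of i "n"] Suc_times_binomial_eq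
      by (metis (no_types) binomial_absorption mult.commute of_nat_mult)
    have "q (Suc i) = (of_nat (Suc i) * of_nat (l choose Suc i)) / (of_nat (Suc i) * of_nat (M choose Suc i))"
      unfolding q_def by (subst mult_divide_mult_cancel_left) (simp_all del: of_nat_Suc)
    also have "\<dots> = of_nat (l - i) / of_nat (M - i) * q i"
      unfolding absorb q_def by simp
    finally have "of_nat (M - i) * q (Suc i) = of_nat (l - i) * q i"
      using i assms by simp
    then have "T (Suc i) = - (of_nat (l - i) * q i) / of_nat (M + 1 - l)"
      by (simp add: T_def)
    then have "T (Suc i) - T i = (of_nat (M + 1 - i) - of_nat (l - i)) * q i / of_nat (M + 1 - l)"
      unfolding T_def by (simp add: diff_divide_distrib left_diff_distrib)
    also have "of_nat (M + 1 - i) - of_nat (l - i) = (of_nat (M + 1 - l) :: rat)"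
      using i assms by (simp add: of_nat_diff)
    finally show ?thesis
      using assms by simp
  qed
  have "(\<Sum>i\<le>l. q i) = (\<Sum>i<Suc l. T (Suc i) - T i)"
    using step by (intro sum.cong) auto
  also have "\<dots> = T (Suc l) - T 0"
    by (rule sum_lessThan_telescope)
  also have "\<dots> = of_nat (M + 1) / of_nat (M + 1 - l)"
  proof -
    have "T (Suc l) = 0" and "T 0 = - (of_nat (M + 1) / of_nat (M + 1 - l))"
      by (simp_all add: T_def q_def binomial_eq_0 del: of_nat_add of_nat_Suc)
    then show ?thesis
      by simp
  qed
  finally show ?thesis
    by (simp add: q_def)
qed

text \<open>Raising l to l + 1 adds C(l,i-1) / i = C(l+1,i) / (l+1) to each C(l,i) / i. The sum of
  \<open>sum_binomial_quotient\<close> without its term i = 0, divided by l + 1, is 1 / (M -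
  l).\<close>

lemma sum_binomial_quotient_divide:
  assumes "l \<le> M"
  shows "(\<Sum>i=1..l. of_nat (l choose i) / (of_nat i * of_nat (M choose i))) =
    (\<Sum>s=1..l. 1 / of_nat (M + 1 - s) :: rat)"
  using assms
proof (induction l)
  case (Suc l)
  define f where "f n i = (of_nat (n choose i) / (of_nat i * of_nat (M choose i)) :: rat)" for n i
  have "(\<Sum>i=1..Suc l. f (Suc l) i) = (\<Sum>i=1..Suc l. f l i +
      of_nat (Suc l choose i) / of_nat (M choose i) / of_nat (Suc l))"
  proof (rule sum.cong)
    fix i assume i: "i \<in> {1..Suc l}"
    then obtain k where k: "i = k + 1" "k \<le> l"
      by (cases i) auto
    have "of_nat (l choose k) / of_nat i = (of_nat (Suc l choose i) / of_nat (Suc l) :: rat)"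
      using binomial_times_inverse_Suc[of k "Suc l"] k by simp
    then have "of_nat (l choose k) / (of_nat i * of_nat (M choose i)) =
        (of_nat (Suc l choose i) / of_nat (M choose i) / of_nat (Suc l) :: rat)"
      by (metis divide_divide_eq_left mult.commute)
    moreover have "f (Suc l) i = f l i + of_nat (l choose k) / (of_nat i * of_nat (M choose i))"
      by (simp add: f_def k add_divide_distrib)
    ultimately show "f (Suc l) i = f l i + of_nat (Suc l choose i) / of_nat (M choose i) / of_nat (Suc l)"
      by simp
  qed simp
  also have "\<dots> = (\<Sum>i=1..l. f l i) +
      (\<Sum>i=1..Suc l. of_nat (Suc l choose i) / of_nat (M choose i)) / of_nat (Suc l)"
    unfolding sum.distrib sum_divide_distrib by (simp add: f_def binomial_eq_0)
  also have "(\<Sum>i=1..Suc l. of_nat (Suc l choose i) / of_nat (M choose i)) =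
      (\<Sum>i\<le>Suc l. of_nat (Suc l choose i) / of_nat (M choose i)) - (1 :: rat)"
    by (simp only: sum.atMost_shift sum.atLeast1_atMost_eq One_nat_def)
      (simp del: binomial_Suc_Suc sum.lessThan_Suc)
  also have "\<dots> = of_nat (Suc l) / of_nat (M + 1 - Suc l)"
    using Suc.prems by (subst sum_binomial_quotient) (simp_all add: field_simps of_nat_diff)
  finally show ?case
    using Suc by (simp add: f_def del: of_nat_Suc)
qed simp

lemma central_binomial_Suc:
  "of_nat (k + 1) * of_nat ((2 * (k + 1)) choose (k + 1)) =
    (of_nat (4 * k + 2) * of_nat ((2 * k) choose k) :: rat)"
proof -
  have "of_nat ((2 * n) choose n) = (fact (2 * n) / (fact n * fact n) :: rat)" for n
    using binomial_fact[of n "2 * n", where ?'a = rat] by simp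
  note b = this[of k] this[of "k + 1"]
  have "2 * (k + 1) = Suc (Suc (2 * k))"
    by simp
  then have "fact (2 * (k + 1)) = (of_nat (2 * (k + 1)) * of_nat (2 * k + 1) * fact (2 * k) :: rat)"
    by (simp only: fact_Suc) simp
  moreover have "fact (k + 1) = (of_nat (k + 1) * fact k :: rat)"
    by simp
  moreover have "of_nat (k + 1) \<noteq> (0 :: rat)"
    by (simp only: of_nat_eq_0_iff)
  ultimately show ?thesis
    unfolding b by (simp add: field_simps del: of_nat_add of_nat_Suc) (simp add: algebra_simps)
qed

section \<open>Divisibility of binomial coefficients by p\<close>

context prime_modulus
begin

lemma prime_dvd_central_binomial:
  assumes "p \<le> 2 * k" and "k < p"
  shows "p dvd ((2 * k) choose k)"
proof -
  have "fact k * fact k * ((2 * k) choose k) = (fact (2 * k) :: nat)"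
    using binomial_fact_lemma[of k "2 * k"] by simp
  moreover have "p dvd (fact (2 * k) :: nat)"
    using assms prime by (simp add: prime_dvd_fact_iff)
  moreover have "\<not> p dvd (fact k :: nat)"
    using assms prime by (simp add: prime_dvd_fact_iff)
  ultimately show ?thesis
    using prime by (metis prime_dvd_mult_iff)
qed

lemma not_prime_dvd_binomial:
  assumes "n < p" and "k \<le> n"
  shows "\<not> p dvd (n choose k)"
proof -
  have "fact k * fact (n - k) * (n choose k) = (fact n :: nat)"
    using assms(2) by (rule binomial_fact_lemma)
  moreover have "\<not> p dvd (fact n :: nat)"
    using assms prime by (simp add: prime_dvd_fact_iff)
  ultimately show ?thesis
    by (metis dvd_mult)
qed

end

section \<open>The Franel sums modulo p\<close>

locale prime_ge_5 = prime_modulus +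
  assumes p_ge_5: "p \<ge> 5"
begin

definition m :: nat where "m = (p - 1) div 2"

lemma p_eq: "p = 2 * m + 1"
proof -
  have "odd p"
    using prime p_ge_5 by (simp add: prime_odd_nat)
  then show ?thesis
    by (auto simp: m_def elim: oddE)
qed

lemma not_dvd_small: "\<not> p dvd 2" "\<not> p dvd 3" "\<not> p dvd 4"
  using p_ge_5 by (auto dest: dvd_imp_le)

text \<open>C(2k,k) = (-4)^k C(-1/2,k), and m is -1/2 modulo p.\<close>

lemma central_binomial_cong_p:
  assumes "k \<le> m"
  shows "of_nat ((2 * k) choose k) \<simeq> (-4) ^ k * of_nat (m choose k)"
  using assms
proof (induction k)
  case (Suc k)
  have "of_nat (k + 1) * of_nat ((2 * (k + 1)) choose (k + 1)) =
      (of_nat (4 * k + 2) * of_nat ((2 * k) choose k) :: rat)"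
    by (rule central_binomial_Suc)
  also have "\<dots> \<simeq> of_nat (4 * k + 2) * ((-4) ^ k * of_nat (m choose k))"
    using Suc by (intro cong_p_scale) simp_all
  \<comment> \<open>Subtracting 2 p leaves 4 k + 2 - 2 p = -4 (m - k), the factor in the recursion
    of (-4)^k C(m,k).\<close>
  also have "\<dots> \<simeq> (of_nat (4 * k + 2) - 2 * of_nat p) * ((-4) ^ k * of_nat (m choose k))"
    by (rule cong_p_mult_p[of "2 * ((-4) ^ k * of_nat (m choose k))"]) (simp_all add: algebra_simps)
  also have "\<dots> = of_nat (k + 1) * ((-4) ^ (k + 1) * of_nat (m choose (k + 1)))"
  proof -
    have "Suc k * (m choose Suc k) = (m - k) * (m choose k)"
      by (metis binomial_absorb_comp binomial_absorption mult.commute)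
    then have "of_nat (k + 1) * of_nat (m choose (k + 1)) = (of_nat m - of_nat k) * (of_nat (m choose k) :: rat)"
      using Suc.prems by (metis Suc_eq_plus1 Suc_leD of_nat_diff of_nat_mult)
    then have "of_nat (k + 1) * ((-4) ^ (k + 1) * of_nat (m choose (k + 1))) =
        (-4) ^ (k + 1) * ((of_nat m - of_nat k) * (of_nat (m choose k) :: rat))"
      by (metis mult.left_commute)
    also have "\<dots> = (of_nat (4 * k + 2) - 2 * of_nat p) * ((-4) ^ k * of_nat (m choose k))"
      by (subst p_eq) (simp add: algebra_simps)
    finally show ?thesis ..
  qed
  finally have "of_nat (k + 1) * of_nat ((2 * (k + 1)) choose (k + 1)) \<simeq>
      of_nat (k + 1) * ((-4) ^ (k + 1) * of_nat (m choose (k + 1)))" .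
  moreover have "\<not> p dvd (k + 1)"
    using Suc.prems p_eq by (intro not_dvd_less) auto
  ultimately show ?case
    using cong_p_cancel by (metis Suc_eq_plus1)
qed simp

lemma p_integral_gen_harm: "n < p \<Longrightarrow> p_integral (gen_harm r n)"
  unfolding gen_harm_def
  by (intro p_integral_sum) (use p_integral_power[OF p_integral_inverse] in \<open>auto simp: power_one_over\<close>)

text \<open>The closed form v is only available while the support n <= 2k fits below p, that is, for
  k <= m. For larger k the prime divides C(2k,k), and p-integrality of the weights makes the whole
  term vanish modulo p.\<close>

lemma alternating_franel_sum_cong_p:
  assumes "\<And>n. n < p \<Longrightarrow> p_integral (w n)"
    and "\<And>k. 2 * k < p \<Longrightarrow> (\<Sum>n<p. franel_coeff k n * w n) = v k"
  shows "(\<Sum>n<p. (-1) ^ n * of_nat (franel n) * w n) \<simeq> (\<Sum>k\<le>m. (-4) ^ k * of_nat (m choose k) * v k)"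
proof -
  have int: "p_integral (\<Sum>n<p. franel_coeff k n * w n)" for k
    using assms(1) by (intro p_integral_sum p_integral_mult) (auto simp: franel_coeff_def)
  have "(\<Sum>n<p. (-1) ^ n * of_nat (franel n) * w n) =
      (\<Sum>k<p. of_nat ((2 * k) choose k) * (\<Sum>n<p. franel_coeff k n * w n))"
    by (rule sum_alternating_franel)
  also have "\<dots> \<simeq> (\<Sum>k<p. if k \<le> m then (-4) ^ k * of_nat (m choose k) * v k else 0)"
  proof (rule cong_p_sum)
    fix k assume "k \<in> {..<p}"
    show "of_nat ((2 * k) choose k) * (\<Sum>n<p. franel_coeff k n * w n) \<simeq>
        (if k \<le> m then (-4) ^ k * of_nat (m choose k) * v k else 0)"
    proof (cases "k \<le> m")
      case True
      then have "(\<Sum>n<p. franel_coeff k n * w n) = v k"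
        using p_eq by (intro assms(2)) auto
      then show ?thesis
        using True int[of k] by (auto intro!: cong_p_mult central_binomial_cong_p)
    next
      case False
      then have "of_nat ((2 * k) choose k) \<simeq> 0"
        using \<open>k \<in> _\<close> p_eq by (intro cong_p_0_if_dvd prime_dvd_central_binomial) auto
      from cong_p_scale[OF int[of k] this] show ?thesis
        using False by (simp add: mult.commute)
    qed
  qed
  also have "\<dots> = (\<Sum>k\<le>m. (-4) ^ k * of_nat (m choose k) * v k)"
    using p_eq by (intro sum.mono_neutral_cong_right) auto
  finally show ?thesis .
qed

text \<open>In the binomial transform C(l-1,k) / (k+1) = C(l,k+1) / l, so the inner sum is ((1-4)^l
  - 1) / l by the binomial theorem.\<close>

lemma alternating_franel_harm_cong_p:
  "(\<Sum>n<p. (-1) ^ n * of_nat (franel n) * gen_harm 1 n) \<simeq>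
    2 * (\<Sum>l=1..m. ((-3) ^ m - (-3) ^ (m - l)) / of_nat l)"
proof -
  have "(\<Sum>n<p. (-1) ^ n * of_nat (franel n) * gen_harm 1 n) \<simeq>
      (\<Sum>k\<le>m. (-4) ^ k * of_nat (m choose k) * (2 * gen_harm 1 k))"
    using sum_franel_coeff_harm by (intro alternating_franel_sum_cong_p p_integral_gen_harm)
  also have "\<dots> = 2 * (\<Sum>k\<le>m. of_nat (m choose k) * ((-4) ^ k * (\<Sum>i=1..k. 1 / of_nat i)))"
    by (simp add: gen_harm_def sum_distrib_left mult_ac)
  also have "\<dots> = 2 * (\<Sum>l=1..m. (1 + (-4)) ^ (m - l) *
      (\<Sum>k<l. of_nat ((l - 1) choose k) * (-4) ^ (k + 1) * (1 / of_nat (k + 1))))"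
    by (subst sum_binomial_partial_sums) simp
  also have "(\<Sum>l=1..m. (1 + (-4)) ^ (m - l) *
      (\<Sum>k<l. of_nat ((l - 1) choose k) * (-4) ^ (k + 1) * (1 / of_nat (k + 1)))) =
      (\<Sum>l=1..m. ((-3) ^ m - (-3) ^ (m - l)) / (of_nat l :: rat))"
  proof (rule sum.cong)
    fix l assume l: "l \<in> {1..m}"
    have "(\<Sum>k<l. of_nat ((l - 1) choose k) * (-4) ^ (k + 1) * (1 / of_nat (k + 1))) =
        (\<Sum>k<l. of_nat (l choose (k + 1)) * (-4) ^ (k + 1)) / (of_nat l :: rat)"
      unfolding sum_divide_distrib
    proof (rule sum.cong)
      fix k assume "k \<in> {..<l}"
      then show "of_nat ((l - 1) choose k) * (-4) ^ (k + 1) * (1 / of_nat (k + 1)) =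
          of_nat (l choose (k + 1)) * (-4) ^ (k + 1) / (of_nat l :: rat)"
        using binomial_times_inverse_Suc[of k l] by (metis lessThan_iff mult.commute times_divide_eq_left times_divide_eq_right mult_1)
    qed simp
    also have "(\<Sum>k<l. of_nat (l choose (k + 1)) * (-4) ^ (k + 1)) = (-3) ^ l - (1 :: rat)"
    proof -
      have "(-4 + 1) ^ l = (\<Sum>k\<le>l. of_nat (l choose k) * (-4) ^ k :: rat)"
        unfolding binomial_ring by simp
      then show ?thesis
        by (simp add: sum.atMost_shift)
    qed
    finally show "(1 + (-4)) ^ (m - l) *
        (\<Sum>k<l. of_nat ((l - 1) choose k) * (-4) ^ (k + 1) * (1 / of_nat (k + 1))) =
        ((-3) ^ m - (-3) ^ (m - l)) / (of_nat l :: rat)"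
      using l by (simp add: right_diff_distrib flip: power_add)
  qed simp
  finally show ?thesis .
qed

text \<open>Replacing C(2i,i) by (-4)^i C(m,i) in the denominators as well lets the powers of -4
  cancel in the binomial transform; what remains is \<open>sum_binomial_quotient_divide\<close> with
  M = m.\<close>

lemma alternating_franel_harm_square_cong_p:
  "(\<Sum>n<p. (-1) ^ n * of_nat (franel n) * gen_harm 2 n) \<simeq>
    - 6 * (\<Sum>l=1..m. (-3) ^ (m - l) / of_nat l * (\<Sum>s=1..l. 1 / of_nat (2 * s - 1)))"
proof -
  define a where "a i = (3 / (of_nat i ^ 2 * ((-4) ^ i * of_nat (m choose i))) :: rat)" for i
  have a: "3 / (of_nat i ^ 2 * of_nat ((2 * i) choose i)) \<simeq> a i" if i: "i \<in> {1..m}" for i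
  proof -
    have nd: "\<not> p dvd i" "\<not> p dvd ((2 * i) choose i)" "\<not> p dvd (m choose i)"
      using not_dvd_less[of i] not_prime_dvd_binomial[of "2 * i" i] not_prime_dvd_binomial[of m i]
        i p_eq by auto
    have "1 / of_nat ((2 * i) choose i) \<simeq> 1 / ((-4) ^ i * of_nat (m choose i))"
    proof (rule cong_p_inverse)
      show "of_nat ((2 * i) choose i) \<simeq> (-4) ^ i * of_nat (m choose i)"
        using i by (intro central_binomial_cong_p) simp
      show "p_integral (1 / of_nat ((2 * i) choose i))"
        using nd by (intro p_integral_divide_of_nat) simp_all
      have "\<not> p dvd 4 ^ i * (m choose i)"
        using nd not_dvd_small prime by (auto simp: prime_dvd_mult_iff dest: prime_dvd_power)
      then have "p_integral ((-1) ^ i / of_nat (4 ^ i * (m choose i)))"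
        by (intro p_integral_divide_of_nat) simp_all
      moreover have "(-1) ^ i / of_nat (4 ^ i * (m choose i)) = 1 / ((-4) ^ i * of_nat (m choose i) :: rat)"
        using power_mult_distrib[of "-1 :: rat" 4 i] by (cases "even i") simp_all
      ultimately show "p_integral (1 / ((-4) ^ i * of_nat (m choose i)))"
        by simp
    qed (use i in simp_all)
    moreover have "p_integral (3 / of_nat (i ^ 2))"
      using nd prime by (intro p_integral_divide_of_nat) (auto dest: prime_dvd_power)
    ultimately have "3 / of_nat (i ^ 2) * (1 / of_nat ((2 * i) choose i)) \<simeq>
        3 / of_nat (i ^ 2) * (1 / ((-4) ^ i * of_nat (m choose i)))"
      by (intro cong_p_scale)
    then show ?thesis
      by (simp add: a_def)
  qed
  have "(\<Sum>n<p. (-1) ^ n * of_nat (franel n) * gen_harm 2 n) \<simeq>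
      (\<Sum>k\<le>m. (-4) ^ k * of_nat (m choose k) * apery_partial_sum k)"
    using sum_franel_coeff_harm_square by (intro alternating_franel_sum_cong_p p_integral_gen_harm)
  also have "\<dots> \<simeq> (\<Sum>k\<le>m. (-4) ^ k * of_nat (m choose k) * (\<Sum>i=1..k. a i))"
    unfolding apery_partial_sum_def using a by (intro cong_p_sum cong_p_scale) auto
  also have "\<dots> = (\<Sum>k\<le>m. of_nat (m choose k) * ((-4) ^ k * (\<Sum>i=1..k. a i)))"
    by (simp add: mult_ac)
  also have "\<dots> = (\<Sum>l=1..m. (1 + (-4)) ^ (m - l) *
      (\<Sum>k<l. of_nat ((l - 1) choose k) * (-4) ^ (k + 1) * a (k + 1)))"
    by (rule sum_binomial_partial_sums)
  also have "\<dots> = (\<Sum>l=1..m. (-3) ^ (m - l) / of_nat l * (\<Sum>s=1..l. 3 * (1 / of_nat (m + 1 - s))))"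
  proof (rule sum.cong)
    fix l assume l: "l \<in> {1..m}"
    have "(\<Sum>k<l. of_nat ((l - 1) choose k) * (-4) ^ (k + 1) * a (k + 1)) =
        (\<Sum>k<l. 3 / of_nat l * (of_nat (l choose (k + 1)) / (of_nat (k + 1) * of_nat (m choose (k + 1)))))"
    proof (rule sum.cong)
      fix k assume "k \<in> {..<l}"
      then have "of_nat ((l - 1) choose k) / of_nat (k + 1) = (of_nat (l choose (k + 1)) / of_nat l :: rat)"
        by (intro binomial_times_inverse_Suc) simp
      moreover have "of_nat ((l - 1) choose k) * (-4) ^ (k + 1) * a (k + 1) =
          3 * (of_nat ((l - 1) choose k) / of_nat (k + 1)) / (of_nat (k + 1) * of_nat (m choose (k + 1)))"
        unfolding a_def power2_eq_square by (simp del: of_nat_add of_nat_Suc power_Suc)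
      ultimately show "of_nat ((l - 1) choose k) * (-4) ^ (k + 1) * a (k + 1) =
          3 / of_nat l * (of_nat (l choose (k + 1)) / (of_nat (k + 1) * of_nat (m choose (k + 1))))"
        by simp
    qed simp
    also have "\<dots> = 3 / of_nat l * (\<Sum>i=1..l. of_nat (l choose i) / (of_nat i * of_nat (m choose i)))"
      by (simp add: sum_distrib_left sum.atLeast1_atMost_eq)
    also have "\<dots> = 3 / of_nat l * (\<Sum>s=1..l. 1 / of_nat (m + 1 - s))"
      using l by (subst sum_binomial_quotient_divide) auto
    finally show "(1 + (-4)) ^ (m - l) *
        (\<Sum>k<l. of_nat ((l - 1) choose k) * (-4) ^ (k + 1) * a (k + 1)) =
        (-3) ^ (m - l) / of_nat l * (\<Sum>s=1..l. 3 * (1 / of_nat (m + 1 - s)))"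
      by (simp add: sum_distrib_left)
  qed simp
  also have "\<dots> \<simeq> (\<Sum>l=1..m. (-3) ^ (m - l) / of_nat l * (\<Sum>s=1..l. 3 * (-2 * (1 / of_nat (2 * s - 1)))))"
  proof (intro cong_p_sum cong_p_scale)
    fix l assume l: "l \<in> {1..m}"
    then show "p_integral ((-3) ^ (m - l) / of_nat l)"
      using p_eq by (intro p_integral_divide_of_nat not_dvd_less) auto
    fix s assume "s \<in> {1..l}"
    with l have ls: "l \<in> {1..m}" "s \<in> {1..l}"
      by simp_all
    \<comment> \<open>So 1 / (m + 1 - s) is -2 / (2s - 1) modulo p, which turns the factor 3 into
      -6.\<close>
    have "2 * (m + 1 - s) = p - (2 * s - 1)"
      using ls p_eq by auto
    then have "1 / of_nat (m + 1 - s) = (2 * (1 / of_nat (p - (2 * s - 1))) :: rat)"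
      using ls by (metis (no_types, opaque_lifting) mult.commute nonzero_mult_divide_mult_cancel_right
          of_nat_mult of_nat_numeral times_divide_eq_right mult_1 zero_neq_numeral)
    also have "\<dots> \<simeq> 2 * (- 1 / of_nat (2 * s - 1))"
      using ls p_eq by (intro cong_p_scale cong_p_inverse_reflect) auto
    finally show "1 / of_nat (m + 1 - s) \<simeq> -2 * (1 / of_nat (2 * s - 1))"
      by simp
  qed simp_all
  also have "\<dots> = - 6 * (\<Sum>l=1..m. (-3) ^ (m - l) / of_nat l * (\<Sum>s=1..l. 1 / of_nat (2 * s - 1)))"
    by (simp add: sum_distrib_left mult_ac sum_negf)
  finally show ?thesis .
qed

end

section \<open>The sum with harmonic numbers of order one\<close>

definition chi3 :: "int \<Rightarrow> int" where
  "chi3 a = (if a mod 3 = 0 then 0 else if a mod 3 = 1 then 1 else -1)"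

lemma chi3_cong: "a mod 3 = b mod 3 \<Longrightarrow> chi3 a = chi3 b"
  by (simp add: chi3_def)

lemma mod_3_cases: "a mod 3 = 0 \<or> a mod 3 = 1 \<or> a mod 3 = (2 :: int)"
  by presburger

lemma chi3_mult: "chi3 (a * b) = chi3 a * chi3 b"
proof -
  have "chi3 (a * b) = chi3 ((a mod 3) * (b mod 3))"
    by (rule chi3_cong) (simp add: mod_mult_eq)
  then show ?thesis
    using mod_3_cases[of a] mod_3_cases[of b] by (elim disjE) (simp_all add: chi3_def)
qed

lemma chi3_minus: "chi3 (- a) = - chi3 a"
  using chi3_mult[of "-1" a] by (simp add: chi3_def)

lemma chi3_double: "chi3 (2 * a) = - chi3 a"
  using chi3_mult[of 2 a] by (simp add: chi3_def)

text \<open>The numbers b - a, b, b + a run through all residues modulo 3, so their characters add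
  up to 0, and \<open>chi3\<close> is odd.\<close>

lemma chi3_diff_eq:
  assumes "a mod 3 \<noteq> 0"
  shows "chi3 (a - b) = chi3 b + chi3 (a + b)"
proof -
  define u v where "u = a mod 3" and "v = b mod 3"
  have "chi3 (a - b) = chi3 (u - v)" "chi3 (a + b) = chi3 (u + v)" "chi3 b = chi3 v"
    by (rule chi3_cong, simp add: u_def v_def mod_diff_eq mod_add_eq)+
  moreover have "u = 1 \<or> u = 2"
    using mod_3_cases[of a] assms by (auto simp: u_def)
  moreover have "v = 0 \<or> v = 1 \<or> v = 2"
    using mod_3_cases[of b] by (simp add: v_def)
  ultimately show ?thesis
    by (elim disjE) (simp_all add: chi3_def)
qed

lemma Legendre_3: "Legendre a 3 = chi3 a"
proof -
  have "QuadRes 3 a \<longleftrightarrow> a mod 3 \<noteq> 2"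
  proof
    assume "QuadRes 3 a"
    then obtain y where "y\<^sup>2 mod 3 = a mod 3"
      by (auto simp: QuadRes_def cong_def)
    then have "a mod 3 = (y mod 3)\<^sup>2 mod 3"
      by (simp add: power_mod)
    then show "a mod 3 \<noteq> 2"
      using mod_3_cases[of y] by (elim disjE) simp_all
  next
    assume "a mod 3 \<noteq> 2"
    then have "[0\<^sup>2 = a] (mod 3) \<or> [1\<^sup>2 = a] (mod 3)"
      using mod_3_cases[of a] by (auto simp: cong_def)
    then show "QuadRes 3 a"
      unfolding QuadRes_def by blast
  qed
  then show ?thesis
    using mod_3_cases[of a] unfolding Legendre_def chi3_def cong_def by (elim disjE) simp_all
qed

text \<open>This is (P(s) - P(-s)) / (2 s) for a square root s of -3. Taking residues modulo x^2 + 3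
  keeps it rational, so that congruences modulo p apply.\<close>

definition lin_coeff :: "rat poly \<Rightarrow> rat" where
  "lin_coeff P = Polynomial.coeff (P mod [:3, 0, 1:]) 1"

lemma lin_coeff_add: "lin_coeff (P + Q) = lin_coeff P + lin_coeff Q"
  by (simp add: lin_coeff_def poly_mod_add_left)

lemma lin_coeff_smult: "lin_coeff (Polynomial.smult c P) = c * lin_coeff P"
  by (simp add: lin_coeff_def mod_smult_left)

lemma lin_coeff_sum: "lin_coeff (sum f A) = (\<Sum>i\<in>A. lin_coeff (f i))"
  by (induction A rule: infinite_finite_induct) (simp_all add: lin_coeff_add, simp_all add: lin_coeff_def)

lemma lin_coeff_monom:
  "lin_coeff (Polynomial.monom 1 (2 * i)) = 0" "lin_coeff (Polynomial.monom 1 (2 * i + 1)) = (-3) ^ i"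
proof -
  have step: "lin_coeff (Polynomial.monom 1 (n + 2)) = - 3 * lin_coeff (Polynomial.monom 1 n)" for n
  proof -
    have "Polynomial.monom 1 (n + 2) = Polynomial.smult (-3) (Polynomial.monom 1 n) + [:3, 0, 1:] * Polynomial.monom (1 :: rat) n"
      by (simp add: monom_altdef numeral_2_eq_2)
    then have "Polynomial.monom 1 (n + 2) mod [:3, 0, 1:] = Polynomial.smult (-3) (Polynomial.monom 1 n) mod [:3, 0, 1 :: rat:]"
      by (simp only: mod_mult_self2)
    then show ?thesis
      by (simp add: lin_coeff_def mod_smult_left)
  qed
  show "lin_coeff (Polynomial.monom 1 (2 * i)) = 0"
  proof (induction i)
    case 0
    show ?case
      by (simp add: lin_coeff_def mod_poly_less)
  next
    case (Suc i)
    then show ?case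
      using step[of "2 * i"] by simp
  qed
  show "lin_coeff (Polynomial.monom 1 (2 * i + 1)) = (-3) ^ i"
  proof (induction i)
    case 0
    show ?case
      by (simp add: lin_coeff_def mod_poly_less monom_altdef)
  next
    case (Suc i)
    then show ?case
      using step[of "2 * i + 1"] by simp
  qed
qed

lemma lin_coeff_eq_sum:
  assumes "degree P \<le> 2 * n + 1"
  shows "lin_coeff P = (\<Sum>i\<le>n. Polynomial.coeff P (2 * i + 1) * (-3) ^ i)"
proof -
  have "lin_coeff P = lin_coeff (\<Sum>i\<le>2 * n + 1. Polynomial.monom (Polynomial.coeff P i) i)"
    using assms by (subst poly_as_sum_of_monoms') auto
  also have "\<dots> = (\<Sum>i\<le>2 * n + 1. Polynomial.coeff P i * lin_coeff (Polynomial.monom 1 i))"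
    unfolding lin_coeff_sum by (simp add: smult_monom flip: lin_coeff_smult)
  also have "\<dots> = (\<Sum>i\<le>n. Polynomial.coeff P (2 * i + 1) * (-3) ^ i)"
  proof (induction n)
    case 0
    show ?case
      using lin_coeff_monom[of 0] by simp
  next
    case (Suc n)
    then show ?case
      using lin_coeff_monom[of "Suc n"] by simp
  qed
  finally show ?thesis .
qed

text \<open>
  Modulo \<open>x^2 + 3\<close> the polynomial \<open>w = (x - 1) / 2\<close> is a primitive cube root of unity, and
  \<open>x + 1 = - 2 w^2\<close>; moreover \<open>2 w^r = rho r + chi3 r * x\<close> with \<open>rho\<close> as in the proof.
\<close>

lemma lin_coeff_linear_powers:
  assumes "a + b > 0"
  shows "lin_coeff ([:-1, 1:] ^ a * [:1, 1:] ^ b) =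
    2 ^ (a + b - 1) * (-1) ^ b * of_int (chi3 (int a - int b))"
proof -
  define rho :: "int \<Rightarrow> rat" where "rho r = (if r mod 3 = 0 then 2 else -1)" for r
  \<comment> \<open>The residue of (2 w)^a (- 2 w^2)^b; since w^2 is the inverse of w, only the
    integer exponent a - b of w matters.\<close>
  define R :: "nat \<Rightarrow> nat \<Rightarrow> rat poly" where
    "R a b = Polynomial.smult (2 ^ (a + b) / 2 * (-1) ^ b)
      [:rho (int a - int b), of_int (chi3 (int a - int b)):]" for a b
  have shift: "rho (r + 1) = (- rho r - 3 * of_int (chi3 r)) / 2"
    "of_int (chi3 (r + 1)) = (rho r - of_int (chi3 r)) / 2"
    "rho (r - 1) = (- rho r + 3 * of_int (chi3 r)) / 2"
    "of_int (chi3 (r - 1)) = (- rho r - of_int (chi3 r)) / 2" for r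
  proof -
    have "r mod 3 = 0 \<and> (r + 1) mod 3 = 1 \<and> (r - 1) mod 3 = 2 \<or>
      r mod 3 = 1 \<and> (r + 1) mod 3 = 2 \<and> (r - 1) mod 3 = 0 \<or>
      r mod 3 = 2 \<and> (r + 1) mod 3 = 0 \<and> (r - 1) mod 3 = 1"
      by presburger
    then show "rho (r + 1) = (- rho r - 3 * of_int (chi3 r)) / 2"
      "of_int (chi3 (r + 1)) = (rho r - of_int (chi3 r)) / 2"
      "rho (r - 1) = (- rho r + 3 * of_int (chi3 r)) / 2"
      "of_int (chi3 (r - 1)) = (- rho r - of_int (chi3 r)) / 2"
      by (auto simp: rho_def chi3_def)
  qed
  let ?Q = "[:3, 0, 1:] :: rat poly"
  have A: "([:-1, 1:] * R a b) mod ?Q = R (a + 1) b mod ?Q" for a b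
  proof -
    define X Y where "X = rho (int a - int b)" and "Y = (of_int (chi3 (int a - int b)) :: rat)"
    define c :: rat where "c = 2 ^ (a + b) / 2 * (-1) ^ b"
    have "int (a + 1) - int b = (int a - int b) + 1"
      by simp
    then have "R (a + 1) b = Polynomial.smult (2 * c) [:(- X - 3 * Y) / 2, (X - Y) / 2:]"
      unfolding R_def X_def Y_def c_def by (simp only: shift) simp
    then have R1: "R (a + 1) b = Polynomial.smult c [:- X - 3 * Y, X - Y:]"
      by (simp add: field_simps)
    have "R a b = Polynomial.smult c [:X, Y:]"
      by (simp add: R_def X_def Y_def c_def)
    then have "[:-1, 1:] * R a b = R (a + 1) b + ?Q * Polynomial.smult c [:Y:]"
      unfolding R1 by (simp add: algebra_simps)
    then show ?thesis
      by (simp only: mod_mult_self2)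
  qed
  have B: "([:1, 1:] * R a b) mod ?Q = R a (b + 1) mod ?Q" for a b
  proof -
    define X Y where "X = rho (int a - int b)" and "Y = (of_int (chi3 (int a - int b)) :: rat)"
    define c :: rat where "c = 2 ^ (a + b) / 2 * (-1) ^ b"
    have "int a - int (b + 1) = (int a - int b) - 1"
      by simp
    then have "R a (b + 1) = Polynomial.smult (- 2 * c) [:(- X + 3 * Y) / 2, (- X - Y) / 2:]"
      unfolding R_def X_def Y_def c_def by (simp only: shift) simp
    then have R1: "R a (b + 1) = Polynomial.smult c [:X - 3 * Y, X + Y:]"
      by (simp add: field_simps)
    have "R a b = Polynomial.smult c [:X, Y:]"
      by (simp add: R_def X_def Y_def c_def)
    then have "[:1, 1:] * R a b = R a (b + 1) + ?Q * Polynomial.smult c [:Y:]"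
      unfolding R1 by (simp add: algebra_simps)
    then show ?thesis
      by (simp only: mod_mult_self2)
  qed
  have "([:-1, 1:] ^ a * [:1, 1:] ^ b) mod ?Q = R a b mod ?Q"
  proof (induction a)
    case 0
    show ?case
    proof (induction b)
      case 0
      show ?case
        by (simp add: R_def rho_def chi3_def one_pCons)
    next
      case (Suc b)
      have "([:1, 1:] * [:1, 1:] ^ b) mod ?Q = ([:1, 1:] * R 0 b) mod ?Q"
        using Suc by (intro mod_mult_cong) simp_all
      then show ?case
        using B[of 0 b] by simp
    qed
  next
    case (Suc a)
    have "([:-1, 1:] * ([:-1, 1:] ^ a * [:1, 1:] ^ b)) mod ?Q = ([:-1, 1:] * R a b) mod ?Q"
      using Suc by (intro mod_mult_cong) simp_all
    then show ?case
      using A[of a b] by (simp only: power_Suc mult.assoc flip: Suc_eq_plus1)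
  qed
  also have "R a b mod ?Q = R a b"
    by (rule mod_poly_less) (simp add: R_def)
  finally show ?thesis
    using assms by (cases "a + b") (simp_all add: lin_coeff_def R_def)
qed

section \<open>Exact binomial identities and their quotients by p\<close>

context prime_ge_5
begin

text \<open>Two evaluations of \<open>lin_coeff\<close> at (1 + x)^p: by
  \<open>lin_coeff_linear_powers\<close>, and from the odd coefficients. As p is odd, the symmetry
  of the binomial coefficients turns odd lower indices into even ones.\<close>

lemma sum_even_binomial_lin_coeff:
  "(\<Sum>i\<le>m. of_nat (p choose (2 * i)) * (-3) ^ (m - i)) = (2 ^ (p - 1) * of_int (chi3 (int p)) :: rat)"
proof -
  have "lin_coeff ([:1, 1:] ^ p) = 2 ^ (p - 1) * (-1) ^ p * of_int (chi3 (- int p))"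
    using lin_coeff_linear_powers[of 0 p] p_gt_0 by simp
  also have "\<dots> = 2 ^ (p - 1) * of_int (chi3 (int p))"
  proof -
    have "(-1) ^ p = (-1 :: rat)"
      by (subst p_eq) simp
    then show ?thesis
      by (simp add: chi3_minus)
  qed
  finally have "2 ^ (p - 1) * of_int (chi3 (int p)) =
      (\<Sum>i\<le>m. Polynomial.coeff ([:1, 1:] ^ p :: rat poly) (2 * i + 1) * (-3) ^ i)"
    using p_eq by (subst (asm) lin_coeff_eq_sum[of _ m]) (simp_all add: degree_linear_power)
  also have "\<dots> = (\<Sum>i\<le>m. of_nat (p choose (2 * i + 1)) * (-3) ^ i)"
    by (intro sum.cong) (use p_eq in \<open>simp_all add: coeff_linear_poly_power\<close>)
  also have "\<dots> = (\<Sum>i\<le>m. of_nat (p choose (2 * i)) * (-3) ^ (m - i))"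
  proof (rule sum.reindex_bij_witness[of _ "\<lambda>i. m - i" "\<lambda>i. m - i"])
    fix i assume "i \<in> {..m}"
    then have "p - (2 * i + 1) = 2 * (m - i)" "2 * i + 1 \<le> p"
      using p_eq by auto
    then show "of_nat (p choose (2 * (m - i))) * (-3) ^ (m - (m - i)) =
        (of_nat (p choose (2 * i + 1)) * (-3) ^ i :: rat)"
      using binomial_symmetric[of "2 * i + 1" p] \<open>i \<in> _\<close> by simp
  qed auto
  finally show ?thesis ..
qed

lemma sum_even_binomial:
  "(\<Sum>i\<le>m. of_nat (p choose (2 * i))) = (2 ^ (p - 1) :: rat)"
proof -
  have "2 * (\<Sum>i\<le>p. if even i then of_nat (p choose i) else 0) = (2 ^ p :: rat)"
    using p_gt_0 by (rule choose_even_sum)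
  moreover have "(\<Sum>i\<le>p. if even i then of_nat (p choose i) else 0 :: rat) =
      (\<Sum>i\<in>{i. i \<le> p \<and> even i}. of_nat (p choose i))"
    by (rule sum.mono_neutral_cong_right) auto
  moreover have "\<dots> = (\<Sum>i\<le>m. of_nat (p choose (2 * i)))"
    using p_eq by (intro sum.reindex_bij_witness[of _ "\<lambda>i. 2 * i" "\<lambda>i. i div 2"]) auto
  moreover have "(2 :: rat) ^ p = 2 * 2 ^ (p - 1)"
    using p_gt_0 by (simp flip: power_Suc)
  ultimately show ?thesis
    by simp
qed

lemma sum_even_binomial_divide_cong_p:
  assumes "\<And>i. i \<in> {1..m} \<Longrightarrow> p_integral (c i)"
  shows "(\<Sum>i=1..m. of_nat (p choose (2 * i)) * c i) / of_nat p \<simeq> - (\<Sum>i=1..m. c i / of_nat i) / 2"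
proof -
  have "(\<Sum>i=1..m. of_nat (p choose (2 * i)) * c i) / of_nat p =
      (\<Sum>i=1..m. c i * (of_nat (p choose (2 * i)) / of_nat p))"
    by (simp add: sum_divide_distrib mult.commute)
  also have "\<dots> \<simeq> (\<Sum>i=1..m. c i * (- ((-1) ^ (2 * i) / of_nat (2 * i))))"
    using p_eq by (intro cong_p_sum cong_p_scale assms binomial_prime_divide) auto
  also have "\<dots> = - (\<Sum>i=1..m. c i / of_nat i) / 2"
    by (simp add: sum_negf sum_divide_distrib mult.commute)
  finally show ?thesis .
qed

text \<open>Let X = chi3 p, (-3)^m = X + p e, and q the Fermat quotient of 2. The two exact
  identities divided by p give H = -2 q and G = -2 (q X - e) modulo p, so q cancels in (-3)^m H - G
  and -2 e is left. Squaring (-3)^m shows that the Fermat quotient of 3 is 2 X e modulo p.\<close>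

lemma sum_diff_powers_cong_p:
  "(\<Sum>l=1..m. ((-3) ^ m - (-3) ^ (m - l)) / of_nat l) \<simeq> - of_int (chi3 (int p)) * fermat_quotient p 3"
proof -
  define X :: rat where "X = of_int (chi3 (int p))"
  define P :: rat where "P = of_nat p"
  define H where "H = (\<Sum>l=1..m. 1 / of_nat l :: rat)"
  define G where "G = (\<Sum>l=1..m. (-3) ^ (m - l) / of_nat l :: rat)"
  define e where "e = ((-3) ^ m - X) / P"
  define q where "q = (2 ^ (p - 1) - 1) / P"
  have P: "P \<noteq> 0"
    using p_gt_0 by (simp add: P_def)
  have int: "p_integral X" "p_integral P" "p_integral H"
    using p_eq by (auto simp: X_def P_def H_def intro!: p_integral_sum p_integral_inverse)
  have intG: "p_integral G"
    unfolding G_def using p_eq by (intro p_integral_sum p_integral_divide_of_nat not_dvd_less) auto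
  have "3 < p"
    using p_ge_5 by simp
  then have "\<not> 3 dvd p"
    using prime primes_dvd_imp_eq[of 3 p] by auto
  then have "int p mod 3 \<noteq> 0"
    by presburger
  then have X2: "X * X = 1"
    using mod_3_cases[of "int p"] unfolding X_def chi3_def by (elim disjE) simp_all
  have split: "{..m} = insert 0 {1..m}"
    by auto
  have q: "q \<simeq> - H / 2"
  proof -
    have "(\<Sum>i\<le>m. of_nat (p choose (2 * i))) = 1 + (\<Sum>i=1..m. of_nat (p choose (2 * i)) * 1 :: rat)"
      unfolding split by simp
    then have "q = (\<Sum>i=1..m. of_nat (p choose (2 * i)) * 1) / P"
      by (simp add: q_def sum_even_binomial)
    then show ?thesis
      using sum_even_binomial_divide_cong_p[of "\<lambda>_. 1"] by (simp add: H_def P_def)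
  qed
  have eq: "(2 ^ (p - 1) * X - (-3) ^ m) / P \<simeq> - G / 2"
  proof -
    have "(\<Sum>i\<le>m. of_nat (p choose (2 * i)) * (-3) ^ (m - i)) =
        (-3) ^ m + (\<Sum>i=1..m. of_nat (p choose (2 * i)) * (-3) ^ (m - i) :: rat)"
      unfolding split by simp
    then have *: "(2 ^ (p - 1) * X - (-3) ^ m) / P =
        (\<Sum>i=1..m. of_nat (p choose (2 * i)) * (-3) ^ (m - i)) / P"
      by (simp add: sum_even_binomial_lin_coeff X_def)
    show ?thesis
      unfolding * unfolding G_def P_def by (rule sum_even_binomial_divide_cong_p) simp
  qed
  have half: "p_integral (y / 2)" if "p_integral y" for y
    using p_integral_divide_of_nat[OF that not_dvd_small(1)] by simp
  have qi: "p_integral q"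
    using int half[of H] by (intro cong_p_integral[OF q]) simp
  have "(2 ^ (p - 1) * X - (-3) ^ m) / P = q * X - e"
  proof -
    have "q * X - e = ((2 ^ (p - 1) - 1) * X - ((-3) ^ m - X)) / P"
      by (simp add: q_def e_def diff_divide_distrib left_diff_distrib)
    then show ?thesis
      by (simp add: algebra_simps)
  qed
  then have eqe: "q * X - e \<simeq> - G / 2"
    using eq by simp
  then have "p_integral (q * X - e)"
    using intG half[of G] by (intro cong_p_integral[OF eqe]) simp
  \<comment> \<open>This is Euler's criterion for -3, namely (-3)^m = X modulo p; it falls out of
    the binomial identity without quadratic reciprocity.\<close>
  from p_integral_diff[OF p_integral_mult[OF qi int(1)] this]
  have ei: "p_integral e"
    by simp
  have m3: "(-3) ^ m = X + P * e"
    using P by (simp add: e_def)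
  have "fermat_quotient p 3 = 2 * X * e + P * (e * e)"
  proof -
    have "(3 :: rat) ^ (p - 1) = ((-3) ^ m) ^ 2"
    proof -
      have "p - 1 = 2 * m"
        by (subst p_eq) simp
      then show ?thesis
        by (simp add: power_mult power2_eq_square flip: power_mult_distrib)
    qed
    then have "(3 :: rat) ^ (p - 1) = 1 + P * (2 * X * e + P * (e * e))"
      unfolding m3 power2_eq_square using X2 by (simp add: algebra_simps)
    then show ?thesis
      using P by (simp add: fermat_quotient_def P_def)
  qed
  then have q3: "fermat_quotient p 3 \<simeq> 2 * X * e"
    by (intro cong_p_mult_p[of "e * e"]) (simp_all add: ei P_def)
  have "G \<simeq> - 2 * (q * X - e)"
    using cong_p_scale[OF _ eqe, of "-2"] by (simp add: cong_p_sym)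
  moreover have "H \<simeq> - 2 * q"
    using cong_p_scale[OF _ q, of "-2"] by (simp add: cong_p_sym)
  moreover have "(-3) ^ m \<simeq> X"
    using m3 ei by (intro cong_p_mult_p[of e]) (simp_all add: P_def)
  ultimately have "(-3) ^ m * H - G \<simeq> X * (- 2 * q) - (- 2 * (q * X - e))"
    using qi by (intro cong_p_diff cong_p_mult) simp_all
  also have "\<dots> = - X * (2 * X * e)"
    using X2 by (simp add: algebra_simps)
  also have "\<dots> \<simeq> - X * fermat_quotient p 3"
    using int q3 by (intro cong_p_scale cong_p_sym[OF q3]) simp
  also have "(-3) ^ m * H - G = (\<Sum>l=1..m. ((-3) ^ m - (-3) ^ (m - l)) / of_nat l)"
    by (simp add: H_def G_def sum_distrib_left diff_divide_distrib sum_subtractf)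
  finally show ?thesis
    by (simp add: X_def)
qed

end

section \<open>Character sums of inverse squares\<close>

context prime_ge_5
begin

lemma odd_p: "odd p"
  by (subst p_eq) simp

text \<open>Take for i the half of r modulo p: then r is 2 i modulo p, and 1 / i^2 is 4 /
  r^2.\<close>

lemma sum_inverse_squares_double_cong_p:
  fixes f :: "nat \<Rightarrow> rat"
  assumes "\<And>i. p_integral (f i)"
  shows "(\<Sum>i=1..<p. f i / of_nat i ^ 2) \<simeq>
    4 * (\<Sum>r=1..<p. f (if even r then r div 2 else (r + p) div 2) / of_nat r ^ 2)"
proof -
  let ?h = "\<lambda>r. if even r then r div 2 else (r + p) div 2"
  have reindex: "(\<Sum>i=1..<p. f i / of_nat i ^ 2) = (\<Sum>r=1..<p. f (?h r) / of_nat (?h r) ^ 2)"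
  proof (rule sum.reindex_bij_witness[of _ ?h "\<lambda>i. if 2 * i < p then 2 * i else 2 * i - p"])
    fix i assume i: "i \<in> {1..<p}"
    show inv: "?h (if 2 * i < p then 2 * i else 2 * i - p) = i"
    proof (cases "2 * i < p")
      case False
      then have "odd (2 * i - p)" "2 * i - p + p = 2 * i"
        using odd_p by auto
      then show ?thesis
        using False by simp
    qed simp
    show "(if 2 * i < p then 2 * i else 2 * i - p) \<in> {1..<p}"
    proof -
      have "2 * i \<noteq> p"
        using odd_p by auto
      then show ?thesis
        using i by auto
    qed
    show "f (?h (if 2 * i < p then 2 * i else 2 * i - p)) /
        of_nat (?h (if 2 * i < p then 2 * i else 2 * i - p)) ^ 2 = f i / of_nat i ^ 2"
      by (simp only: inv)
  next
    fix r assume r: "r \<in> {1..<p}"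
    have "even r \<and> 2 * ?h r = r \<or> odd r \<and> 2 * ?h r = r + p"
      using odd_p by auto
    then show "(if 2 * ?h r < p then 2 * ?h r else 2 * ?h r - p) = r" "?h r \<in> {1..<p}"
      using r by auto
  qed
  have "(\<Sum>r=1..<p. f (?h r) / of_nat (?h r) ^ 2) \<simeq> (\<Sum>r=1..<p. 4 * (f (?h r) / of_nat r ^ 2))"
  proof (rule cong_p_sum)
    fix r assume r: "r \<in> {1..<p}"
    define i where "i = ?h r"
    have i: "2 * i = r \<or> 2 * i = r + p"
      using odd_p by (auto simp: i_def)
    then have i0: "i \<noteq> 0"
      using r by auto
    have nd: "\<not> p dvd r"
      using r by (intro not_dvd_less) auto
    then have "\<not> p dvd 2 * i"
      using i by (metis dvd_add_left_iff dvd_refl)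
    then have int_i: "p_integral (1 / of_nat (2 * i))"
      by (rule p_integral_divide_of_nat[OF p_integral_1])
    have "of_nat (2 * i) \<simeq> of_nat r"
    proof (cases "2 * i = r")
      case False
      then have "of_nat (2 * i) - of_nat r = (of_nat p * 1 :: rat)"
        using i by (simp flip: of_nat_mult)
      then show ?thesis
        by (rule cong_p_mult_p[OF p_integral_1])
    qed simp
    then have "1 / of_nat (2 * i) \<simeq> 1 / of_nat r"
      using int_i p_integral_divide_of_nat[OF p_integral_1 nd] r i0
      by (intro cong_p_inverse) simp_all
    with int_i have "(1 / of_nat (2 * i)) ^ 2 \<simeq> (1 / of_nat r) ^ 2"
      by (intro cong_p_power)
    then have "4 * f i * (1 / of_nat (2 * i)) ^ 2 \<simeq> 4 * f i * (1 / of_nat r) ^ 2"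
      using assms by (intro cong_p_scale) simp_all
    moreover have "4 * f i * (1 / of_nat (2 * i)) ^ 2 = f i / of_nat i ^ 2"
      using i0 by (simp add: power2_eq_square)
    ultimately show "f (?h r) / of_nat (?h r) ^ 2 \<simeq> 4 * (f (?h r) / of_nat r ^ 2)"
      unfolding i_def[symmetric] by (simp add: power_one_over)
  qed
  then show ?thesis
    unfolding sum_distrib_left reindex by assumption
qed

lemma sum_inverse_squares_reflect_cong_p:
  fixes f :: "nat \<Rightarrow> rat"
  assumes "\<And>i. p_integral (f i)"
  shows "(\<Sum>i=1..<p. f (p - i) / of_nat i ^ 2) \<simeq> (\<Sum>i=1..<p. f i / of_nat i ^ 2)"
proof -
  have "(\<Sum>i=1..<p. f (p - i) / of_nat i ^ 2) \<simeq> (\<Sum>i=1..<p. f (p - i) / of_nat (p - i) ^ 2)"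
  proof (rule cong_p_sum)
    fix i assume "i \<in> {1..<p}"
    then have "f (p - i) * (1 / of_nat i ^ 2) \<simeq> f (p - i) * (1 / of_nat (p - i) ^ 2)"
      using assms by (intro cong_p_scale cong_p_sym[OF cong_p_inverse_square_reflect]) auto
    then show "f (p - i) / of_nat i ^ 2 \<simeq> f (p - i) / of_nat (p - i) ^ 2"
      by simp
  qed
  also have "\<dots> = (\<Sum>i=1..<p. f i / of_nat i ^ 2)"
    by (rule sum_reflect)
  finally show ?thesis .
qed

text \<open>By the doubling substitution the sum S satisfies S = 4 S modulo p, and p does not divide
  3.\<close>

lemma sum_inverse_squares_cong_p_0: "(\<Sum>i=1..<p. 1 / of_nat i ^ 2) \<simeq> 0"
proof -
  let ?S = "\<Sum>i=1..<p. 1 / of_nat i ^ 2 :: rat"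
  have "?S \<simeq> 4 * ?S"
    using sum_inverse_squares_double_cong_p[of "\<lambda>_. 1"] by simp
  from cong_p_diff[OF cong_p_sym[OF this] cong_p_refl[of ?S]] have "of_nat 3 * ?S \<simeq> of_nat 3 * 0"
    by simp
  then show ?thesis
    using not_dvd_small(2) by (rule cong_p_cancel)
qed

lemma not_3_dvd_p: "int p mod 3 \<noteq> 0"
proof -
  have "\<not> 3 dvd p"
    using prime primes_dvd_imp_eq[of 3 p] p_ge_5 by auto
  then show ?thesis
    by presburger
qed

definition chi3_sum :: rat where
  "chi3_sum = (\<Sum>j=1..<p. of_int (chi3 (int j)) / of_nat j ^ 2)"

text \<open>Let A and B be the sums over even j of chi3 (p + j) / j^2 and chi3 j / j^2. Reflection
  gives -A and B + A for the corresponding sums over odd j. Modulo p, \<open>chi3_sum\<close> is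
  then 2 B + A and, by halving, also -4 (B - A), while the alternating sum is 2 A; finally 6 A = 2
  (2 B + A) - 4 (B - A).\<close>

lemma alternating_chi3_sum_cong_p:
  "(\<Sum>j=1..<p. of_int ((-1) ^ j * chi3 (int p + int j)) / of_nat j ^ 2) \<simeq> chi3_sum"
proof -
  define E where "E g = (\<Sum>j=1..<p. of_int (if even j then g (int j) else 0) / of_nat j ^ 2 :: rat)"
    for g :: "int \<Rightarrow> int"
  define D where "D g = (\<Sum>j=1..<p. of_int (if odd j then g (int j) else 0) / of_nat j ^ 2 :: rat)"
    for g :: "int \<Rightarrow> int"
  have reflect: "D (\<lambda>j. g (int p - j)) \<simeq> E g" for g
  proof -
    have "E g \<simeq> (\<Sum>i=1..<p. of_int (if even (p - i) then g (int (p - i)) else 0) / of_nat i ^ 2)"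
      unfolding E_def
      by (rule cong_p_sym[OF sum_inverse_squares_reflect_cong_p[of "\<lambda>j. of_int (if even j then g (int j) else 0)"]])
        simp
    also have "\<dots> = D (\<lambda>j. g (int p - j))"
      unfolding D_def using odd_p by (intro sum.cong) (auto simp: of_nat_diff)
    finally show ?thesis
      by (rule cong_p_sym)
  qed
  define A B where "A = E (\<lambda>j. chi3 (int p + j))" and "B = E chi3"
  have "D (\<lambda>j. chi3 (int p + j)) = - D (\<lambda>j. chi3 (int p + (int p - j)))"
  proof -
    have eq: "chi3 (int p + j) = - chi3 (int p + (int p - j))" for j
      unfolding chi3_minus[symmetric] by (rule chi3_cong) presburger
    show ?thesis
      unfolding D_def sum_negf[symmetric]
    proof (intro sum.cong refl)
      fix j
      show "of_int (if odd j then chi3 (int p + int j) else 0) / of_nat j ^ 2 =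
          - (of_int (if odd j then chi3 (int p + (int p - int j)) else 0) / of_nat j ^ 2 :: rat)"
        using eq[of "int j"] by simp
    qed
  qed
  also have "\<dots> \<simeq> - A"
    unfolding A_def using reflect[of "\<lambda>j. chi3 (int p + j)"] by (rule cong_p_minus)
  finally have DA: "D (\<lambda>j. chi3 (int p + j)) \<simeq> - A" .
  have "D chi3 \<simeq> E (\<lambda>j. chi3 (int p - j))"
    using reflect[of "\<lambda>j. chi3 (int p - j)"] by simp
  also have "E (\<lambda>j. chi3 (int p - j)) = B + A"
  proof -
    have "chi3 (int p - j) = chi3 j + chi3 (int p + j)" for j
      using not_3_dvd_p by (rule chi3_diff_eq)
    then show ?thesis
      unfolding A_def B_def E_def sum.distrib[symmetric]
      by (intro sum.cong) (simp_all add: add_divide_distrib)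
  qed
  finally have DB: "D chi3 \<simeq> B + A" .
  have "chi3_sum = B + D chi3"
    unfolding chi3_sum_def B_def E_def D_def sum.distrib[symmetric] by (intro sum.cong) auto
  with cong_p_add[OF cong_p_refl[of B] DB] have Z1: "chi3_sum \<simeq> B + (B + A)"
    by simp
  have "chi3_sum \<simeq> 4 * (\<Sum>r=1..<p. of_int (chi3 (int (if even r then r div 2 else (r + p) div 2))) / of_nat r ^ 2)"
    unfolding chi3_sum_def by (rule sum_inverse_squares_double_cong_p) simp
  also have "(\<Sum>r=1..<p. of_int (chi3 (int (if even r then r div 2 else (r + p) div 2))) / of_nat r ^ 2) =
      - (B + D (\<lambda>j. chi3 (int p + j)))"
  proof -
    have "chi3 (int (if even r then r div 2 else (r + p) div 2)) =
        - ((if even r then chi3 (int r) else 0) + (if odd r then chi3 (int p + int r) else 0))" for r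
    proof (cases "even r")
      case True
      then obtain t where "r = 2 * t"
        by blast
      then show ?thesis
        by (simp add: chi3_double)
    next
      case False
      then have "even (r + p)"
        using odd_p by simp
      then obtain t where t: "r + p = 2 * t"
        by blast
      then have "int p + int r = 2 * int t"
        by linarith
      then have "chi3 (int p + int r) = - chi3 (int t)"
        by (metis chi3_double)
      then show ?thesis
        using False t by simp
    qed
    then show ?thesis
      unfolding B_def E_def D_def sum.distrib[symmetric] sum_negf[symmetric]
      by (intro sum.cong) (simp_all only: of_int_minus of_int_add minus_divide_left flip: add_divide_distrib)
  qed
  also have "4 * (- (B + D (\<lambda>j. chi3 (int p + j)))) \<simeq> 4 * (- (B + - A))"
    by (intro cong_p_scale cong_p_minus cong_p_add DA) simp_all
  finally have Z2: "chi3_sum \<simeq> 4 * (- (B + - A))" .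
  let ?N = "\<Sum>j=1..<p. of_int ((-1) ^ j * chi3 (int p + int j)) / of_nat j ^ 2"
  have "?N = A - D (\<lambda>j. chi3 (int p + j))"
    unfolding A_def E_def D_def sum_subtractf[symmetric] by (intro sum.cong) auto
  also have "\<dots> \<simeq> A - (- A)"
    by (intro cong_p_diff DA cong_p_refl)
  finally have "3 * ?N \<simeq> 3 * (A - (- A))"
    by (intro cong_p_scale) simp_all
  also have "\<dots> = 2 * (B + (B + A)) + 4 * (- (B + - A))"
    by simp
  also have "\<dots> \<simeq> 2 * chi3_sum + chi3_sum"
    by (intro cong_p_add cong_p_scale cong_p_sym[OF Z1] cong_p_sym[OF Z2]) simp
  finally have "of_nat 3 * ?N \<simeq> of_nat 3 * chi3_sum"
    by simp
  then show ?thesis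
    using not_dvd_small(2) by (rule cong_p_cancel)
qed

end

section \<open>The homogenised finite dilogarithm\<close>

definition x_minus_1 :: "rat poly" where "x_minus_1 = [:-1, 1:]"
definition x_plus_1 :: "rat poly" where "x_plus_1 = [:1, 1:]"

definition mixed :: "nat \<Rightarrow> nat \<Rightarrow> rat poly" where
  "mixed a b = x_minus_1 ^ a * x_plus_1 ^ b"

lemma pderiv_sum_smult:
  "pderiv (\<Sum>i\<in>A. Polynomial.smult (c i) (P i)) = (\<Sum>i\<in>A. Polynomial.smult (c i) (pderiv (P i)))"
  by (induction A rule: infinite_finite_induct) (simp_all add: pderiv_add pderiv_smult)

lemma smult_sum_right: "Polynomial.smult c (sum f A) = (\<Sum>i\<in>A. Polynomial.smult c (f i))"
  by (induction A rule: infinite_finite_induct) (simp_all add: smult_add_right)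

text \<open>Writing x + 1 = 2 + (x - 1) collects the exponents into the factor a + b + 2. With total
  exponent p, that term vanishes modulo p.\<close>

lemma pderiv_mixed:
  "pderiv (mixed (Suc a) (Suc b)) =
    Polynomial.smult (2 * of_nat (Suc a)) (mixed a b) + Polynomial.smult (of_nat (a + b + 2)) (mixed (Suc a) b)"
proof -
  have "pderiv x_minus_1 = 1" "pderiv x_plus_1 = 1"
    by (simp_all add: x_minus_1_def x_plus_1_def pderiv_pCons)
  then have "pderiv (mixed (Suc a) (Suc b)) =
      Polynomial.smult (of_nat (Suc a)) (x_plus_1 * mixed a b) +
      Polynomial.smult (of_nat (Suc b)) (mixed (Suc a) b)"
    unfolding mixed_def pderiv_mult pderiv_power_Suc by (simp add: algebra_simps smult_add_left)
  also have "x_plus_1 * mixed a b = Polynomial.smult 2 (mixed a b) + mixed (Suc a) b"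
  proof -
    have eq: "x_plus_1 = [:2:] + x_minus_1"
      by (simp add: x_minus_1_def x_plus_1_def)
    have "x_plus_1 * P = Polynomial.smult 2 P + x_minus_1 * P" for P
      unfolding eq by (simp add: algebra_simps)
    then show ?thesis
      by (simp add: mixed_def mult.assoc)
  qed
  also have "Polynomial.smult c (Polynomial.smult 2 P + Q) + Polynomial.smult d Q =
      Polynomial.smult (2 * c) P + Polynomial.smult (c + d) Q" for c d :: rat and P Q
    by (simp add: smult_add_right smult_add_left mult.commute add.assoc)
  also have "of_nat (Suc a) + of_nat (Suc b) = (of_nat (a + b + 2) :: rat)"
    by simp
  finally show ?thesis .
qed

section \<open>Coefficients of the finite dilogarithm modulo p\<close>

context prime_ge_5
begin

definition dilog_poly :: "rat poly" where
  "dilog_poly = (\<Sum>j=1..<p. Polynomial.smult (1 / of_nat j ^ 2) (mixed j (p - j)))"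

definition log_poly :: "rat poly" where
  "log_poly = (\<Sum>j=1..<p. Polynomial.smult (1 / of_nat j) (mixed j (p - j)))"

definition integral_poly :: "rat poly \<Rightarrow> bool" where
  "integral_poly P \<longleftrightarrow> (\<forall>n. p_integral (Polynomial.coeff P n))"

lemma integral_poly_mult: "integral_poly P \<Longrightarrow> integral_poly Q \<Longrightarrow> integral_poly (P * Q)"
  unfolding integral_poly_def coeff_mult by simp

lemma integral_poly_power: "integral_poly P \<Longrightarrow> integral_poly (P ^ n)"
  by (induction n) (auto simp: integral_poly_mult, simp add: integral_poly_def)

lemma integral_poly_smult: "p_integral c \<Longrightarrow> integral_poly P \<Longrightarrow> integral_poly (Polynomial.smult c P)"
  by (simp add: integral_poly_def)

lemma integral_poly_sum: "(\<And>i. i \<in> A \<Longrightarrow> integral_poly (f i)) \<Longrightarrow> integral_poly (sum f A)"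
  unfolding integral_poly_def by (simp add: Polynomial.coeff_sum)

lemma integral_poly_mixed: "integral_poly (mixed a b)"
  unfolding mixed_def x_minus_1_def x_plus_1_def
  by (intro integral_poly_mult integral_poly_power)
    (auto simp: integral_poly_def coeff_pCons split: nat.splits)

lemma p_integral_inverse_power: "0 < j \<Longrightarrow> j < p \<Longrightarrow> p_integral (1 / of_nat j ^ n)"
  using p_integral_power[OF p_integral_inverse, of j n] by (simp add: power_one_over)

lemma p_integral_of_int_divide: "0 < j \<Longrightarrow> j < p \<Longrightarrow> p_integral (of_int a / of_nat j ^ n)"
  using p_integral_mult[OF p_integral_of_int[of a] p_integral_inverse_power[of j n]] by simp

lemma pderiv_mixed_p:
  assumes "0 < j" and "j < p"
  shows "pderiv (mixed j (p - j)) = Polynomial.smult (2 * of_nat j) (mixed (j - 1) (p - 1 - j)) +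
    Polynomial.smult (of_nat p) (mixed j (p - 1 - j))"
proof -
  obtain a where a: "j = Suc a"
    using assms by (cases j) auto
  obtain b where b: "p - j = Suc b"
    using assms by (cases "p - j") auto
  have "p - 1 - j = b" "a + b + 2 = p"
    using a b assms by auto
  then show ?thesis
    using pderiv_mixed[of a b] by (simp only: a b[unfolded a] diff_Suc_1)
qed

text \<open>Modulo p each derivative is 2 j times a product with exponents j - 1 and p - 1 - j. With
  2 = (x + 1) - (x - 1) their weighted sum becomes a difference of (p-1)-th powers.\<close>

lemma coeff_pderiv_log_poly_cong_p:
  "Polynomial.coeff (pderiv log_poly) n \<simeq> Polynomial.coeff (x_plus_1 ^ (p - 1) - x_minus_1 ^ (p - 1)) n"
proof -
  define R where "R = (\<Sum>j=1..<p. Polynomial.smult (1 / of_nat j) (mixed j (p - 1 - j)))"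
  have "pderiv log_poly = (\<Sum>j=1..<p. Polynomial.smult (1 / of_nat j) (pderiv (mixed j (p - j))))"
    by (simp only: log_poly_def pderiv_sum_smult)
  also have "\<dots> = (\<Sum>j=1..<p. Polynomial.smult 2 (mixed (j - 1) (p - 1 - j)) +
      Polynomial.smult (of_nat p) (Polynomial.smult (1 / of_nat j) (mixed j (p - 1 - j))))"
    by (intro sum.cong) (auto simp: pderiv_mixed_p smult_add_right)
  also have "\<dots> = [:2:] * (\<Sum>j=1..<p. mixed (j - 1) (p - 1 - j)) + Polynomial.smult (of_nat p) R"
    unfolding R_def sum.distrib sum_distrib_left smult_sum_right by simp
  also have "[:2:] = x_plus_1 - x_minus_1"
    by (simp add: x_minus_1_def x_plus_1_def)
  also have "(x_plus_1 - x_minus_1) * (\<Sum>j=1..<p. mixed (j - 1) (p - 1 - j)) =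
      x_plus_1 ^ (p - 1) - x_minus_1 ^ (p - 1)"
  proof -
    have "(\<Sum>j=1..<p. mixed (j - 1) (p - 1 - j)) = (\<Sum>i<p-1. x_minus_1 ^ (p - 1 - Suc i) * x_plus_1 ^ i)"
    proof (rule sum.reindex_bij_witness[of _ "\<lambda>i. p - 1 - i" "\<lambda>j. p - 1 - j"])
      fix j assume "j \<in> {1..<p}"
      then have "1 \<le> j" "j < p"
        by simp_all
      then have "p - 1 - Suc (p - 1 - j) = j - 1"
        by arith
      then show "x_minus_1 ^ (p - 1 - Suc (p - 1 - j)) * x_plus_1 ^ (p - 1 - j) = mixed (j - 1) (p - 1 - j)"
        by (simp only: mixed_def)
    qed auto
    then show ?thesis
      using power_diff_sumr2[of x_plus_1 "p - 1" x_minus_1] by simp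
  qed
  finally have eq: "pderiv log_poly = x_plus_1 ^ (p - 1) - x_minus_1 ^ (p - 1) + Polynomial.smult (of_nat p) R" .
  have "integral_poly R"
    unfolding R_def by (intro integral_poly_sum integral_poly_smult integral_poly_mixed p_integral_inverse) auto
  then have "p_integral (Polynomial.coeff R n)"
    by (simp add: integral_poly_def)
  then show ?thesis
    by (rule cong_p_mult_p) (simp add: eq)
qed

text \<open>For even n the coefficients of x^(n-1) in (x + 1)^(p-1) and (x - 1)^(p-1) have opposite
  signs, so their difference is 2 C(p-1,n-1), which is -2 modulo p.\<close>

lemma coeff_log_poly_cong_p:
  assumes "even n" and "0 < n" and "n < p"
  shows "Polynomial.coeff log_poly n \<simeq> - 2 / of_nat n"
proof -
  obtain k where k: "n = Suc k"
    using assms by (cases n) auto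
  have "of_nat n * Polynomial.coeff log_poly n = Polynomial.coeff (pderiv log_poly) k"
    by (simp add: coeff_pderiv k)
  also have "\<dots> \<simeq> Polynomial.coeff (x_plus_1 ^ (p - 1) - x_minus_1 ^ (p - 1)) k"
    by (rule coeff_pderiv_log_poly_cong_p)
  also have "\<dots> = 2 * of_nat ((p - 1) choose k)"
  proof -
    have "odd (p - 1 - k)"
      using assms k odd_p by auto
    then show ?thesis
      using assms k by (simp add: x_plus_1_def x_minus_1_def coeff_linear_poly_power)
  qed
  also have "\<dots> \<simeq> 2 * (-1) ^ k"
    using assms k by (intro cong_p_scale binomial_prime_minus_one) auto
  also have "\<dots> = of_nat n * (- 2 / of_nat n)"
  proof -
    have "(-1) ^ k = (-1 :: rat)"
      using assms k by simp
    moreover have "of_nat n * (- 2 / of_nat n) = (- 2 :: rat)"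
      using assms by simp
    ultimately show ?thesis
      by simp
  qed
  finally show ?thesis
    using not_dvd_less[OF assms(2,3)] by (rule cong_p_cancel)
qed

text \<open>The factor x^2 - 1 restores the exponents lowered by differentiation, and the factor j
  of the derivative turns 1 / j^2 into 1 / j.\<close>

lemma pderiv_dilog_poly:
  obtains R where "integral_poly R"
    and "[:-1, 0, 1:] * pderiv dilog_poly = Polynomial.smult 2 log_poly + Polynomial.smult (of_nat p) R"
proof
  define R where "R = (\<Sum>j=1..<p. Polynomial.smult (1 / of_nat j ^ 2) (mixed (j + 1) (p - j)))"
  show "integral_poly R"
    unfolding R_def
    by (intro integral_poly_sum integral_poly_smult integral_poly_mixed p_integral_inverse_power) auto
  have step: "[:-1, 0, 1:] * mixed a b = mixed (a + 1) (b + 1)" for a b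
  proof -
    have "[:-1, 0, 1:] = x_minus_1 * x_plus_1"
      by (simp add: x_minus_1_def x_plus_1_def)
    then show ?thesis
      by (simp add: mixed_def mult_ac)
  qed
  have "[:-1, 0, 1:] * pderiv dilog_poly =
      (\<Sum>j=1..<p. Polynomial.smult (1 / of_nat j ^ 2) ([:-1, 0, 1:] * pderiv (mixed j (p - j))))"
    by (simp only: dilog_poly_def pderiv_sum_smult sum_distrib_left mult_smult_right)
  also have "\<dots> = (\<Sum>j=1..<p. Polynomial.smult 2 (Polynomial.smult (1 / of_nat j) (mixed j (p - j))) +
      Polynomial.smult (of_nat p) (Polynomial.smult (1 / of_nat j ^ 2) (mixed (j + 1) (p - j))))"
  proof (rule sum.cong)
    fix j assume j: "j \<in> {1..<p}"
    then have "j - 1 + 1 = j" "p - 1 - j + 1 = p - j"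
      by auto
    moreover have "0 < j" "j < p"
      using j by auto
    ultimately have "[:-1, 0, 1:] * pderiv (mixed j (p - j)) =
        Polynomial.smult (2 * of_nat j) (mixed j (p - j)) + Polynomial.smult (of_nat p) (mixed (j + 1) (p - j))"
      by (simp only: pderiv_mixed_p distrib_left mult_smult_right step)
    then show "Polynomial.smult (1 / of_nat j ^ 2) ([:-1, 0, 1:] * pderiv (mixed j (p - j))) =
        Polynomial.smult 2 (Polynomial.smult (1 / of_nat j) (mixed j (p - j))) +
        Polynomial.smult (of_nat p) (Polynomial.smult (1 / of_nat j ^ 2) (mixed (j + 1) (p - j)))"
      using j by (simp only: smult_add_right smult_smult) (simp add: power2_eq_square)
  qed simp
  finally show "[:-1, 0, 1:] * pderiv dilog_poly = Polynomial.smult 2 log_poly + Polynomial.smult (of_nat p) R"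
    by (simp only: sum.distrib log_poly_def R_def smult_sum_right)
qed

text \<open>The coefficient of x^n in \<open>pderiv_dilog_poly\<close>. For even n it links two odd
  coefficients, and these are the ones that \<open>lin_coeff\<close> sees.\<close>

lemma coeff_dilog_poly_step_cong_p:
  assumes "even n" and "2 \<le> n" and "n < p"
  shows "of_nat (n - 1) * Polynomial.coeff dilog_poly (n - 1) -
    of_nat (n + 1) * Polynomial.coeff dilog_poly (n + 1) \<simeq> - 4 / of_nat n"
proof -
  obtain R where R: "integral_poly R"
    "[:-1, 0, 1:] * pderiv dilog_poly = Polynomial.smult 2 log_poly + Polynomial.smult (of_nat p) R"
    by (rule pderiv_dilog_poly)
  obtain k where k: "n = Suc (Suc k)"
    using assms by (metis Suc_le_D numeral_2_eq_2 Suc_le_mono)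
  have "of_nat (n - 1) * Polynomial.coeff dilog_poly (n - 1) -
      of_nat (n + 1) * Polynomial.coeff dilog_poly (n + 1) =
      Polynomial.coeff ([:-1, 0, 1:] * pderiv dilog_poly) n"
    by (simp add: k coeff_pderiv)
  also have "\<dots> = 2 * Polynomial.coeff log_poly n + of_nat p * Polynomial.coeff R n"
    unfolding R(2) by simp
  also have "\<dots> \<simeq> 2 * Polynomial.coeff log_poly n"
    by (rule cong_p_mult_p[of "Polynomial.coeff R n"]) (use R in \<open>simp_all add: integral_poly_def\<close>)
  also have "\<dots> \<simeq> 2 * (- 2 / of_nat n)"
    using assms by (intro cong_p_scale coeff_log_poly_cong_p) auto
  finally show ?thesis
    by simp
qed

lemma integral_poly_dilog_poly: "integral_poly dilog_poly"
  unfolding dilog_poly_def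
  by (intro integral_poly_sum integral_poly_smult integral_poly_mixed p_integral_inverse_power) auto

lemma p_integral_coeff_dilog_poly: "p_integral (Polynomial.coeff dilog_poly n)"
  using integral_poly_dilog_poly by (simp add: integral_poly_def)

text \<open>Descent from the index p, where the factor p gives 0. The step at n = p - (2l + 1)
  contributes -4 / n, which is 4 / (2l + 1) modulo p.\<close>

lemma coeff_dilog_poly_cong_p:
  assumes "l \<le> m"
  shows "of_nat (p - 2 * l) * Polynomial.coeff dilog_poly (p - 2 * l) \<simeq>
    4 * (\<Sum>s=1..l. 1 / of_nat (2 * s - 1))"
  using assms
proof (induction l)
  case 0
  show ?case
    by (rule cong_p_mult_p[OF p_integral_coeff_dilog_poly[of p]]) simp
next
  case (Suc l)
  define n where "n = p - (2 * l + 1)"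
  have "2 * Suc l < p"
    using Suc.prems p_eq by simp
  then have n: "n - 1 = p - 2 * Suc l" "n + 1 = p - 2 * l" "even n" "2 \<le> n" "n < p"
    using odd_p unfolding n_def by simp_all
  have "of_nat (n - 1) * Polynomial.coeff dilog_poly (n - 1) =
      of_nat (n - 1) * Polynomial.coeff dilog_poly (n - 1) -
      of_nat (n + 1) * Polynomial.coeff dilog_poly (n + 1) +
      of_nat (n + 1) * Polynomial.coeff dilog_poly (n + 1)"
    by simp
  also have "\<dots> \<simeq> - 4 / of_nat n + 4 * (\<Sum>s=1..l. 1 / of_nat (2 * s - 1))"
    using Suc n by (intro cong_p_add coeff_dilog_poly_step_cong_p) auto
  also have "\<dots> = (-4) * (1 / of_nat n) + 4 * (\<Sum>s=1..l. 1 / of_nat (2 * s - 1))"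
    by simp
  also have "\<dots> \<simeq> (-4) * (- 1 / of_nat (2 * l + 1)) + 4 * (\<Sum>s=1..l. 1 / of_nat (2 * s - 1))"
    unfolding n_def using Suc.prems p_eq
    by (intro cong_p_add cong_p_scale cong_p_inverse_reflect) auto
  also have "\<dots> = 4 * (\<Sum>s=1..Suc l. 1 / of_nat (2 * s - 1))"
    by (simp add: distrib_left)
  finally show ?case
    unfolding n .
qed

text \<open>Modulo p the derivative does not determine this coefficient. Each
  \<open>mixed j (p - j)\<close> is monic of degree p, so it is the sum of the 1 / j^2.\<close>

lemma coeff_dilog_poly_top_cong_p: "Polynomial.coeff dilog_poly p \<simeq> 0"
proof -
  have "Polynomial.coeff (mixed j (p - j)) p = 1" if "j < p" for j
  proof -
    have "Polynomial.coeff (mixed j (p - j)) (j + (p - j)) = 1"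
    proof -
      have d: "degree (x_minus_1 ^ j) = j" "degree (x_plus_1 ^ (p - j)) = p - j"
        by (simp_all add: x_minus_1_def x_plus_1_def degree_linear_power)
      have "Polynomial.coeff (mixed j (p - j)) (degree (x_minus_1 ^ j) + degree (x_plus_1 ^ (p - j))) =
          lead_coeff (x_minus_1 ^ j) * lead_coeff (x_plus_1 ^ (p - j))"
        unfolding mixed_def by (rule coeff_mult_degree_sum)
      then show ?thesis
        unfolding d by (simp add: x_minus_1_def x_plus_1_def coeff_linear_power)
    qed
    then show ?thesis
      using that by simp
  qed
  then have "Polynomial.coeff dilog_poly p = (\<Sum>j=1..<p. 1 / of_nat j ^ 2)"
    by (simp add: dilog_poly_def Polynomial.coeff_sum)
  then show ?thesis
    using sum_inverse_squares_cong_p_0 by simp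
qed

lemma degree_dilog_poly: "degree dilog_poly \<le> p"
proof -
  have "degree (mixed j (p - j)) \<le> p" if "j < p" for j
  proof -
    have "degree (mixed j (p - j)) \<le> degree (x_minus_1 ^ j) + degree (x_plus_1 ^ (p - j))"
      unfolding mixed_def by (rule degree_mult_le)
    then show ?thesis
      using that by (simp add: x_minus_1_def x_plus_1_def degree_linear_power)
  qed
  then show ?thesis
    unfolding dilog_poly_def by (intro degree_sum_le) (auto intro: order_trans[OF degree_smult_le])
qed

lemma lin_coeff_dilog_poly_cong_p:
  "lin_coeff dilog_poly \<simeq>
    - 2 * (\<Sum>l=1..m. (-3) ^ (m - l) / of_nat l * (\<Sum>s=1..l. 1 / of_nat (2 * s - 1)))"
proof -
  have "lin_coeff dilog_poly = (\<Sum>i\<le>m. Polynomial.coeff dilog_poly (2 * i + 1) * (-3) ^ i)"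
    using degree_dilog_poly p_eq by (intro lin_coeff_eq_sum) simp
  also have "\<dots> = (\<Sum>l\<le>m. (-3) ^ (m - l) * Polynomial.coeff dilog_poly (p - 2 * l))"
  proof (rule sum.reindex_bij_witness[of _ "\<lambda>i. m - i" "\<lambda>i. m - i"])
    fix i assume "i \<in> {..m}"
    then have "p - 2 * (m - i) = 2 * i + 1" "m - (m - i) = i"
      using p_eq by auto
    then show "(-3) ^ (m - (m - i)) * Polynomial.coeff dilog_poly (p - 2 * (m - i)) =
        Polynomial.coeff dilog_poly (2 * i + 1) * (-3) ^ i"
      by (simp only: mult.commute)
  qed auto
  also have "{..m} = insert 0 {1..m}"
    by auto
  also have "(\<Sum>l\<in>insert 0 {1..m}. (-3) ^ (m - l) * Polynomial.coeff dilog_poly (p - 2 * l)) =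
      (-3) ^ m * Polynomial.coeff dilog_poly p +
      (\<Sum>l=1..m. (-3) ^ (m - l) * Polynomial.coeff dilog_poly (p - 2 * l))"
    by simp
  also have "\<dots> \<simeq> (-3) ^ m * 0 +
      (\<Sum>l=1..m. (-3) ^ (m - l) * (- 2 * (1 / of_nat l * (\<Sum>s=1..l. 1 / of_nat (2 * s - 1)))))"
  proof (intro cong_p_add cong_p_scale cong_p_sum coeff_dilog_poly_top_cong_p)
    fix l assume l: "l \<in> {1..m}"
    let ?O = "\<Sum>s=1..l. 1 / of_nat (2 * s - 1) :: rat"
    have O: "p_integral ?O"
      using l p_eq by (intro p_integral_sum p_integral_inverse) auto
    \<comment> \<open>Modulo p the factor p - 2 l is -2 l; dividing 4 by it gives the constant -2 /
      l.\<close>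
    have "- of_nat (2 * l) * Polynomial.coeff dilog_poly (p - 2 * l) \<simeq>
        of_nat (p - 2 * l) * Polynomial.coeff dilog_poly (p - 2 * l)"
    proof (rule cong_p_mult_p)
      show "p_integral (- Polynomial.coeff dilog_poly (p - 2 * l))"
        by (simp add: p_integral_coeff_dilog_poly)
      have "of_nat (p - 2 * l) = of_nat p - (of_nat (2 * l) :: rat)"
        using l p_eq by (simp add: of_nat_diff)
      then show "- of_nat (2 * l) * Polynomial.coeff dilog_poly (p - 2 * l) -
          of_nat (p - 2 * l) * Polynomial.coeff dilog_poly (p - 2 * l) =
          of_nat p * - Polynomial.coeff dilog_poly (p - 2 * l)"
        by (simp only:) (simp add: left_diff_distrib)
    qed
    also have "\<dots> \<simeq> 4 * ?O"
      using l by (intro coeff_dilog_poly_cong_p) simp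
    finally have "- of_nat (2 * l) * Polynomial.coeff dilog_poly (p - 2 * l) \<simeq> 4 * ?O" .
    from cong_p_minus[OF this] have "of_nat (2 * l) * Polynomial.coeff dilog_poly (p - 2 * l) \<simeq>
        of_nat (2 * l) * (- 2 * (1 / of_nat l * ?O))"
      using l by simp
    then show "Polynomial.coeff dilog_poly (p - 2 * l) \<simeq> - 2 * (1 / of_nat l * ?O)"
      by (rule cong_p_cancel[OF _ not_dvd_less]) (use l p_eq in auto)
  qed simp_all
  also have "\<dots> = - 2 * (\<Sum>l=1..m. (-3) ^ (m - l) / of_nat l * (\<Sum>s=1..l. 1 / of_nat (2 * s - 1)))"
    unfolding sum_distrib_left[of "-2"] by (simp add: mult_ac)
  finally show ?thesis .
qed

text \<open>All products have total exponent p, hence the common power of 2. The two signs cancel: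
  (-1)^(p-j) = -(-1)^j, and j - (p - j) is -(p + j) modulo 3.\<close>

lemma lin_coeff_dilog_poly:
  "lin_coeff dilog_poly =
    2 ^ (p - 1) * (\<Sum>j=1..<p. of_int ((-1) ^ j * chi3 (int p + int j)) / of_nat j ^ 2)"
proof -
  have "lin_coeff dilog_poly = (\<Sum>j=1..<p. 1 / of_nat j ^ 2 * lin_coeff (mixed j (p - j)))"
    by (simp add: dilog_poly_def lin_coeff_sum lin_coeff_smult)
  also have "\<dots> = (\<Sum>j=1..<p. 2 ^ (p - 1) * (of_int ((-1) ^ j * chi3 (int p + int j)) / of_nat j ^ 2))"
  proof (rule sum.cong)
    fix j assume j: "j \<in> {1..<p}"
    have "lin_coeff (mixed j (p - j)) = 2 ^ (p - 1) * (-1) ^ (p - j) * of_int (chi3 (int j - int (p - j)))"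
      using j lin_coeff_linear_powers[of j "p - j"] by (simp add: mixed_def x_minus_1_def x_plus_1_def)
    also have "(-1) ^ (p - j) = (- ((-1) ^ j) :: rat)"
      using j odd_p by (cases "even j") auto
    also have "chi3 (int j - int (p - j)) = - chi3 (int p + int j)"
      unfolding chi3_minus[symmetric] using j by (intro chi3_cong) (simp add: of_nat_diff, presburger)
    finally show "1 / of_nat j ^ 2 * lin_coeff (mixed j (p - j)) =
        2 ^ (p - 1) * (of_int ((-1) ^ j * chi3 (int p + int j)) / of_nat j ^ 2)"
      by simp
  qed simp
  finally show ?thesis
    by (simp only: sum_distrib_left)
qed

lemma alternating_franel_harm_square_chi3_sum:
  "(\<Sum>n<p. (-1) ^ n * of_nat (franel n) * gen_harm 2 n) \<simeq> 3 * chi3_sum"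
proof -
  let ?S = "\<Sum>l=1..m. (-3) ^ (m - l) / of_nat l * (\<Sum>s=1..l. 1 / of_nat (2 * s - 1)) :: rat"
  let ?N = "\<Sum>j=1..<p. of_int ((-1) ^ j * chi3 (int p + int j)) / of_nat j ^ 2 :: rat"
  have N: "p_integral ?N"
    by (intro p_integral_sum p_integral_of_int_divide) auto
  have "(\<Sum>n<p. (-1) ^ n * of_nat (franel n) * gen_harm 2 n) \<simeq> - 6 * ?S"
    by (rule alternating_franel_harm_square_cong_p)
  also have "\<dots> = 3 * (- 2 * ?S)"
    by simp
  also have "\<dots> \<simeq> 3 * lin_coeff dilog_poly"
    by (intro cong_p_scale cong_p_sym[OF lin_coeff_dilog_poly_cong_p]) simp
  also have "\<dots> = 3 * ?N * 2 ^ (p - 1)"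
    by (simp add: lin_coeff_dilog_poly)
  also have "\<dots> \<simeq> 3 * ?N * 1"
    using fermat_cong_p[OF not_dvd_small(1)] N by (intro cong_p_scale) simp_all
  also have "\<dots> \<simeq> 3 * chi3_sum"
    using cong_p_scale[OF _ alternating_chi3_sum_cong_p, of 3] by simp
  finally show ?thesis .
qed

end

section \<open>Bernoulli polynomials modulo p\<close>

definition bern_fps :: "'a :: field_char_0 \<Rightarrow> 'a fps" where
  "bern_fps t = Abs_fps (\<lambda>k. bernpoly k t / fact k)"

lemma bern_fps_nth: "fps_nth (bern_fps t) n = bernpoly n t / fact n"
  by (simp add: bern_fps_def)

lemma fps_exp_1_minus_1_nz: "fps_exp 1 - 1 \<noteq> (0 :: 'a :: field_char_0 fps)"
proof -
  have "fps_nth (fps_exp 1 - 1 :: 'a fps) 1 \<noteq> 0"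
    by simp
  then show ?thesis
    by (metis fps_zero_nth)
qed

lemma bern_fps_mult: "bern_fps t * (fps_exp 1 - 1) = fps_X * fps_exp t"
  unfolding bern_fps_def by (rule bernpoly_generating_function)

lemma bernpoly_recurrence:
  "(\<Sum>k\<le>n. of_nat (Suc n choose k) * bernpoly k t) = of_nat (Suc n) * t ^ n"
proof -
  have "fps_nth (bern_fps t * (fps_exp 1 - 1)) (Suc n) = t ^ n / fact n"
    unfolding bern_fps_mult by simp
  then have "(\<Sum>k=0..Suc n. bernpoly k t / fact k * fps_nth (fps_exp 1 - 1) (Suc n - k)) = t ^ n / fact n"
    unfolding fps_mult_nth bern_fps_nth .
  also have "(\<Sum>k=0..Suc n. bernpoly k t / fact k * fps_nth (fps_exp 1 - 1) (Suc n - k)) =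
      (\<Sum>k\<le>n. bernpoly k t / fact k * (1 / fact (Suc n - k)))"
    unfolding sum.atLeast0_atMost_Suc by (simp add: atLeast0AtMost)
  finally have "fact (Suc n) * (\<Sum>k\<le>n. bernpoly k t / fact k * (1 / fact (Suc n - k))) =
      fact (Suc n) * (t ^ n / fact n)"
    by simp
  moreover have "fact (Suc n) * (t ^ n / fact n) = of_nat (Suc n) * t ^ n"
    by simp
  moreover have "fact (Suc n) * (\<Sum>k\<le>n. bernpoly k t / fact k * (1 / fact (Suc n - k))) =
      (\<Sum>k\<le>n. of_nat (Suc n choose k) * bernpoly k t)"
    unfolding sum_distrib_left
  proof (rule sum.cong)
    fix k assume "k \<in> {..n}"
    then have "of_nat (Suc n choose k) = (fact (Suc n) / (fact k * fact (Suc n - k)) :: 'a)"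
      by (intro binomial_fact) simp
    then show "fact (Suc n) * (bernpoly k t / fact k * (1 / fact (Suc n - k))) =
        of_nat (Suc n choose k) * bernpoly k t"
      by simp
  qed simp
  ultimately show ?thesis
    by (simp only:)
qed

lemma bernpoly_add_1: "bernpoly (Suc n) (t + 1) - bernpoly (Suc n) t = of_nat (Suc n) * t ^ n"
proof -
  have "(bern_fps (t + 1) - bern_fps t) * (fps_exp 1 - 1) = (fps_X * fps_exp t) * (fps_exp 1 - 1)"
    by (simp only: left_diff_distrib bern_fps_mult) (simp add: fps_exp_add_mult right_diff_distrib mult.assoc)
  then have "bern_fps (t + 1) - bern_fps t = fps_X * fps_exp t"
    using fps_exp_1_minus_1_nz by (metis mult_right_cancel)
  then have "fps_nth (bern_fps (t + 1) - bern_fps t) (Suc n) = fps_nth (fps_X * fps_exp t) (Suc n)"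
    by (simp only:)
  then have "(bernpoly (Suc n) (t + 1) - bernpoly (Suc n) t) / fact (Suc n) = t ^ n / fact n"
    by (simp add: bern_fps_nth diff_divide_distrib)
  then have "bernpoly (Suc n) (t + 1) - bernpoly (Suc n) t = fact (Suc n) * (t ^ n / fact n)"
    by (simp add: divide_eq_eq mult.commute del: fact_Suc)
  then show ?thesis
    by simp
qed

lemma bernpoly_add_of_nat:
  "bernpoly (Suc n) (t + of_nat N) - bernpoly (Suc n) t = of_nat (Suc n) * (\<Sum>j<N. (t + of_nat j) ^ n)"
proof (induction N)
  case (Suc N)
  have "t + of_nat (Suc N) = t + of_nat N + 1"
    by simp
  then show ?case
    using Suc bernpoly_add_1[of n "t + of_nat N"] by (simp add: algebra_simps)
qed simp

lemma bernpoly_reflect: "bernpoly n (1 - t) = (-1) ^ n * bernpoly n t"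
proof -
  let ?c = "fps_const (-1) * fps_X :: 'a fps"
  define G where "G = bern_fps t oo ?c"
  have "fps_nth ?c 0 = 0"
    by simp
  have "(bern_fps t * (fps_exp 1 - 1)) oo ?c = (fps_X * fps_exp t) oo ?c"
    by (simp only: bern_fps_mult)
  then have "G * (fps_exp (-1) - 1) = ?c * fps_exp (- t)"
    unfolding G_def
    by (simp add: fps_compose_mult_distrib fps_compose_sub_distrib fps_exp_compose_linear del: fps_const_neg)
  moreover have "?c = - fps_X"
    by (simp add: fps_eq_iff)
  ultimately have "G * (fps_exp (-1) - 1) = - fps_X * fps_exp (- t)"
    by (simp only:)
  \<comment> \<open>As -e^x (e^(-x) - 1) = e^x - 1, this factor restores the divisor of the
    generating function after x was replaced by -x.\<close>
  then have "- fps_exp 1 * (G * (fps_exp (-1) - 1)) = - fps_exp 1 * (- fps_X * fps_exp (- t))"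
    by (simp only:)
  moreover have "fps_exp 1 * fps_exp (-1) = (1 :: 'a fps)" "fps_exp 1 * fps_exp (- t) = fps_exp (1 - t)"
    by (simp_all flip: fps_exp_add_mult)
  ultimately have "G * (fps_exp 1 - 1) = fps_X * fps_exp (1 - t)"
    by (simp add: algebra_simps)
  then have "G * (fps_exp 1 - 1) = bern_fps (1 - t) * (fps_exp 1 - 1)"
    by (simp only: bern_fps_mult)
  then have "bern_fps (1 - t) = G"
    using fps_exp_1_minus_1_nz by (metis mult_right_cancel)
  then have "fps_nth (bern_fps (1 - t)) n = (-1) ^ n * fps_nth (bern_fps t) n"
    unfolding G_def fps_compose_linear by simp
  then show ?thesis
    by (simp add: bern_fps_nth)
qed

lemma bernpoly_odd_0:
  assumes "odd n" and "n > 1"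
  shows "bernpoly n 0 = (0 :: 'a :: field_char_0)"
proof -
  obtain k where k: "n = Suc k" "k > 0"
    using assms by (cases n) auto
  have "bernpoly n 1 = (bernpoly n 0 :: 'a)"
    using bernpoly_add_1[of k "0 :: 'a"] k by (simp add: zero_power)
  moreover have "bernpoly n 1 = - (bernpoly n 0 :: 'a)"
    using bernpoly_reflect[of n "0 :: 'a"] assms by simp
  ultimately have "2 * bernpoly n 0 = (0 :: 'a)"
    by (metis add.right_inverse mult_2)
  then show ?thesis
    by simp
qed

section \<open>Bernoulli polynomials at congruent arguments\<close>

context prime_modulus
begin

text \<open>The recurrence expresses (n + 1) B_n through earlier polynomials, and n + 1 < p is
  invertible modulo p. The bound just admits n = p - 2.\<close>

lemma bernpoly_cong_p:
  assumes "n + 1 < p" and "p_integral x" and "x \<simeq> y"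
  shows "p_integral (bernpoly n x) \<and> bernpoly n x \<simeq> bernpoly n y"
  using assms(1)
proof (induction n rule: less_induct)
  case (less n)
  have y: "p_integral y"
    using assms(2) by (rule cong_p_integral[OF cong_p_sym[OF assms(3)]])
  have rec: "of_nat (Suc n) * bernpoly n t =
      of_nat (Suc n) * t ^ n - (\<Sum>k<n. of_nat (Suc n choose k) * bernpoly k t)" for t :: rat
    using bernpoly_recurrence[of n t] by (simp add: algebra_simps flip: lessThan_Suc_atMost)
  have nd: "\<not> p dvd Suc n"
    using less.prems by (intro not_dvd_less) auto
  have "of_nat (Suc n) * bernpoly n x \<simeq> of_nat (Suc n) * bernpoly n y"
    unfolding rec using assms less by (intro cong_p_diff cong_p_sum cong_p_scale cong_p_power) auto
  then have "bernpoly n x \<simeq> bernpoly n y"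
    using nd by (rule cong_p_cancel)
  moreover have "p_integral (of_nat (Suc n) * bernpoly n x)"
    unfolding rec using assms less by (intro p_integral_diff p_integral_sum p_integral_mult p_integral_power) auto
  then have "p_integral (of_nat (Suc n) * bernpoly n x / of_nat (Suc n))"
    using nd by (rule p_integral_divide_of_nat)
  moreover have "of_nat (Suc n) * bernpoly n x / of_nat (Suc n) = bernpoly n x"
    by (simp del: of_nat_Suc)
  ultimately show ?case
    by simp
qed

end

section \<open>Inverse squares in residue classes modulo 3 and the value at 1/3\<close>

context prime_ge_5
begin

text \<open>By Fermat's theorem y^(p-3) is y^(-2) modulo p; here y = i / 3.\<close>

lemma power_third_cong_p:
  assumes "0 < i" and "i < p"
  shows "(of_nat i / 3) ^ (p - 3) \<simeq> 9 * (1 / of_nat i ^ 2)"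
proof -
  have "\<not> p dvd i"
    using assms by (rule not_dvd_less)
  then have "of_nat i ^ (p - 1) \<simeq> 1"
    by (rule fermat_cong_p)
  moreover have "of_nat 3 ^ (p - 1) \<simeq> 1"
    using not_dvd_small(2) by (rule fermat_cong_p)
  then have "1 / 3 ^ (p - 1) \<simeq> 1 / 1"
    using p_integral_power[OF p_integral_divide_of_nat[OF p_integral_1 not_dvd_small(2)], of "p - 1"]
    by (intro cong_p_inverse) (simp_all add: power_one_over)
  ultimately have "of_nat i ^ (p - 1) * (1 / 3 ^ (p - 1)) \<simeq> 1 * (1 / 1)"
    by (intro cong_p_mult) simp_all
  then have "9 * (1 / of_nat i ^ 2) * (of_nat i ^ (p - 1) * (1 / 3 ^ (p - 1))) \<simeq> 9 * (1 / of_nat i ^ 2) * 1"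
    using assms by (intro cong_p_scale p_integral_mult p_integral_inverse_power) simp_all
  moreover have "9 * (1 / of_nat i ^ 2) * (of_nat i ^ (p - 1) * (1 / 3 ^ (p - 1))) = ((of_nat i / 3) ^ (p - 3) :: rat)"
  proof -
    have "p - 1 = (p - 3) + 2"
      using p_ge_5 by simp
    then show ?thesis
      using assms by (simp only: power_add power_divide) simp
  qed
  ultimately show ?thesis
    by simp
qed

definition residue_sum :: "nat \<Rightarrow> rat" where
  "residue_sum c = (\<Sum>i=1..<p. (if i mod 3 = c then 1 else 0) / of_nat i ^ 2)"

lemma residue_sum_reflect: "residue_sum (p mod 3) \<simeq> residue_sum 0"
proof -
  have "residue_sum (p mod 3) = (\<Sum>i=1..<p. (if (p - i) mod 3 = 0 then 1 else 0) / of_nat i ^ 2)"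
    unfolding residue_sum_def
  proof (rule sum.cong)
    fix i assume "i \<in> {1..<p}"
    then have "i < p"
      by simp
    then have "i mod 3 = p mod 3 \<longleftrightarrow> (p - i) mod 3 = 0"
      by presburger
    then show "(if i mod 3 = p mod 3 then 1 else 0) / of_nat i ^ 2 =
        ((if (p - i) mod 3 = 0 then 1 else 0) / of_nat i ^ 2 :: rat)"
      by simp
  qed simp
  also have "\<dots> \<simeq> residue_sum 0"
    unfolding residue_sum_def
    by (rule sum_inverse_squares_reflect_cong_p[of "\<lambda>i. if i mod 3 = 0 then 1 else 0"]) simp
  finally show ?thesis .
qed

lemma sum_residue_sum: "residue_sum 0 + residue_sum 1 + residue_sum 2 \<simeq> 0"
proof -
  have "residue_sum 0 + residue_sum 1 + residue_sum 2 = (\<Sum>i=1..<p. 1 / of_nat i ^ 2)"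
    unfolding residue_sum_def sum.distrib[symmetric]
  proof (rule sum.cong)
    fix i :: nat
    have "i mod 3 = 0 \<or> i mod 3 = 1 \<or> i mod 3 = 2"
      by presburger
    then show "(if i mod 3 = 0 then 1 else 0) / of_nat i ^ 2 + (if i mod 3 = 1 then 1 else 0) / of_nat i ^ 2 +
        (if i mod 3 = 2 then 1 else 0) / of_nat i ^ 2 = (1 / of_nat i ^ 2 :: rat)"
      by (elim disjE) simp_all
  qed simp
  then show ?thesis
    using sum_inverse_squares_cong_p_0 by simp
qed

lemma chi3_sum_eq: "chi3_sum = residue_sum 1 - residue_sum 2"
  unfolding residue_sum_def chi3_sum_def sum_subtractf[symmetric]
proof (rule sum.cong)
  fix i :: nat
  have "i mod 3 = 0 \<and> int i mod 3 = 0 \<or> i mod 3 = 1 \<and> int i mod 3 = 1 \<or> i mod 3 = 2 \<and> int i mod 3 = 2"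
    by presburger
  then show "of_int (chi3 (int i)) / of_nat i ^ 2 =
      (if i mod 3 = 1 then 1 else 0) / of_nat i ^ 2 - ((if i mod 3 = 2 then 1 else 0) / of_nat i ^ 2 :: rat)"
    by (elim disjE conjE) (simp_all add: chi3_def)
qed simp

text \<open>With p = 3 N + a, the difference equation leads in N unit steps from a / 3 to p / 3,
  which is 0 modulo p, and a Bernoulli polynomial of odd index above 1 vanishes at 0. The factor 18
  is 2 times 9: the index p - 2 is -2 modulo p, and ((a + 3 j) / 3)^(p-3) is 9 / (a + 3
  j)^2.\<close>

lemma bernpoly_residue_sum_cong_p:
  "bernpoly (p - 2) (of_nat (p mod 3) / 3) \<simeq> 18 * residue_sum (p mod 3)"
proof -
  define a N where "a = p mod 3" and "N = p div 3"
  have pN: "p = 3 * N + a" "a < 3"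
    by (simp_all add: a_def N_def)
  have a0: "a \<noteq> 0"
    using not_3_dvd_p unfolding a_def by presburger
  define t :: rat where "t = of_nat a / 3"
  define B where "B = bernpoly (p - 2) t"
  have p2: "p - 2 = Suc (p - 3)"
    using p_ge_5 by simp
  have tN: "t + of_nat N = of_nat p / 3"
    using arg_cong[OF pN(1), of "of_nat :: nat \<Rightarrow> rat"] by (simp add: t_def field_simps)
  have third: "p_integral (of_nat n / 3)" for n
    using p_integral_divide_of_nat[OF p_integral_of_nat not_dvd_small(2), of n] by simp
  have "of_nat p / 3 \<simeq> 0"
    using third[of 1] by (intro cong_p_mult_p[of "1 / 3"]) simp_all
  then have "bernpoly (p - 2) (of_nat p / 3) \<simeq> bernpoly (p - 2) 0"
    using third[of p] p_ge_5 bernpoly_cong_p[of "p - 2" "of_nat p / 3" 0] by simp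
  moreover have "bernpoly (p - 2) 0 = (0 :: rat)"
    using p_ge_5 odd_p by (intro bernpoly_odd_0) auto
  ultimately have Bp: "bernpoly (p - 2) (of_nat p / 3) \<simeq> 0"
    by simp
  define S where "S = (\<Sum>j<N. (t + of_nat j) ^ (p - 3))"
  have S_int: "p_integral S"
  proof -
    have "t + of_nat j = of_nat (a + 3 * j) / 3" for j
      by (simp add: t_def field_simps)
    then have "p_integral (t + of_nat j)" for j
      using third[of "a + 3 * j"] by (simp only:)
    then show ?thesis
      unfolding S_def by (intro p_integral_sum p_integral_power)
  qed
  have diff: "bernpoly (p - 2) (of_nat p / 3) - B = of_nat (p - 2) * S"
    using bernpoly_add_of_nat[of "p - 3" t N] unfolding B_def S_def p2[symmetric] tN .
  have "B = bernpoly (p - 2) (of_nat p / 3) - of_nat (p - 2) * S"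
    using diff by simp
  also have "\<dots> \<simeq> 0 - (- 2) * S"
  proof (intro cong_p_diff Bp)
    have "of_nat (p - 2) * S - (- 2) * S = of_nat p * S"
      using p_ge_5 by (simp add: of_nat_diff left_diff_distrib)
    then show "of_nat (p - 2) * S \<simeq> (- 2) * S"
      using S_int by (intro cong_p_mult_p[of S])
  qed
  also have "0 - (- 2) * S = 2 * S"
    by simp
  also have "2 * S \<simeq> 2 * (\<Sum>j<N. 9 * (1 / of_nat (a + 3 * j) ^ 2))"
    unfolding S_def
  proof (intro cong_p_scale cong_p_sum)
    fix j assume "j \<in> {..<N}"
    then have "(of_nat (a + 3 * j) / 3) ^ (p - 3) \<simeq> 9 * (1 / of_nat (a + 3 * j) ^ 2)"
      using a0 pN by (intro power_third_cong_p) auto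
    moreover have "of_nat (a + 3 * j) / 3 = t + of_nat j"
      by (simp add: t_def field_simps)
    ultimately show "(t + of_nat j) ^ (p - 3) \<simeq> 9 * (1 / of_nat (a + 3 * j) ^ 2)"
      by (simp only:)
  qed simp
  also have "(\<Sum>j<N. 9 * (1 / of_nat (a + 3 * j) ^ 2)) = 9 * residue_sum a"
  proof -
    have "residue_sum a = (\<Sum>i\<in>{i \<in> {1..<p}. i mod 3 = a}. 1 / of_nat i ^ 2)"
      unfolding residue_sum_def by (rule sum.mono_neutral_cong_right) auto
    also have "\<dots> = (\<Sum>j<N. 1 / of_nat (a + 3 * j) ^ 2)"
    proof (rule sum.reindex_bij_witness[of _ "\<lambda>j. a + 3 * j" "\<lambda>i. i div 3"])
      fix i assume "i \<in> {i \<in> {1..<p}. i mod 3 = a}"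
      then have i: "i < p" "i mod 3 = a"
        by simp_all
      then show inv: "a + 3 * (i div 3) = i"
        by presburger
      show "i div 3 \<in> {..<N}"
        using i pN inv unfolding lessThan_iff by linarith
      show "1 / of_nat (a + 3 * (i div 3)) ^ 2 = (1 / of_nat i ^ 2 :: rat)"
        by (simp only: inv)
    next
      fix j assume "j \<in> {..<N}"
      then show "(a + 3 * j) div 3 = j" "a + 3 * j \<in> {i \<in> {1..<p}. i mod 3 = a}"
        using pN a0 by auto
    qed
    finally show ?thesis
      by (simp add: sum_distrib_left)
  qed
  finally show ?thesis
    by (simp add: B_def t_def a_def)
qed

text \<open>Since u (p mod 3) is u 0 and the three residue sums add up to 0 modulo p, the difference
  u 1 - u 2 is 3 u 1 if p mod 3 = 1 and -3 u 2 otherwise. In the second case the reflection formula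
  passes from 2/3 to 1/3 with a change of sign, as p - 2 is odd.\<close>

lemma bernpoly_third_cong_p: "1 / 2 * bernpoly (p - 2) (1 / 3) \<simeq> 3 * chi3_sum"
proof -
  define u where "u = residue_sum"
  have u0: "u (p mod 3) \<simeq> u 0" and us: "u 0 + u 1 + u 2 \<simeq> 0"
    and Z: "chi3_sum = u 1 - u 2"
    unfolding u_def by (rule residue_sum_reflect sum_residue_sum chi3_sum_eq)+
  have B: "bernpoly (p - 2) (of_nat (p mod 3) / 3) \<simeq> 18 * u (p mod 3)"
    unfolding u_def by (rule bernpoly_residue_sum_cong_p)
  have "p mod 3 = 1 \<or> p mod 3 = 2"
    using not_3_dvd_p by presburger
  then have "bernpoly (p - 2) (1 / 3) \<simeq> 6 * chi3_sum"
  proof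
    assume p: "p mod 3 = 1"
    \<comment> \<open>Used through 6 (u 1 - u 2) = 12 u 1 - 6 (u 1 + u 2), where u 1 + u 2 is - u 1
      modulo p.\<close>
    have "6 * (u 0 + u 1 + u 2 - u 0) \<simeq> 6 * (0 - u 1)"
      by (intro cong_p_scale cong_p_diff us cong_p_sym[OF u0[unfolded p]]) simp
    from cong_p_diff[OF cong_p_refl[of "12 * u 1"] this] have "6 * chi3_sum \<simeq> 18 * u 1"
      by (simp add: Z algebra_simps)
    moreover have "bernpoly (p - 2) (1 / 3) \<simeq> 18 * u 1"
      using B[unfolded p] by simp
    ultimately show ?thesis
      by (rule cong_p_trans[OF _ cong_p_sym, rotated])
  next
    assume p: "p mod 3 = 2"
    have "bernpoly (p - 2) (1 - 1 / 3) = (-1) ^ (p - 2) * (bernpoly (p - 2) (1 / 3) :: rat)"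
      by (rule bernpoly_reflect)
    moreover have "odd (p - 2)"
      using odd_p p_ge_5 by auto
    ultimately have "bernpoly (p - 2) (2 / 3) = - (bernpoly (p - 2) (1 / 3) :: rat)"
      by simp
    then have "- bernpoly (p - 2) (1 / 3) \<simeq> 18 * u 2"
      using B[unfolded p] by simp
    from cong_p_minus[OF this] have *: "bernpoly (p - 2) (1 / 3) \<simeq> - 18 * u 2"
      by simp
    have "6 * (u 0 + u 1 + u 2 - u 0) \<simeq> 6 * (0 - u 2)"
      by (intro cong_p_scale cong_p_diff us cong_p_sym[OF u0[unfolded p]]) simp
    from cong_p_diff[OF this cong_p_refl[of "12 * u 2"]] have "6 * chi3_sum \<simeq> - 18 * u 2"
      by (simp add: Z algebra_simps)
    then show ?thesis
      by (rule cong_p_trans[OF * cong_p_sym])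
  qed
  then have "of_nat 2 * (1 / 2 * bernpoly (p - 2) (1 / 3)) \<simeq> of_nat 2 * (3 * chi3_sum)"
    by simp
  then show ?thesis
    using not_dvd_small(1) by (rule cong_p_cancel)
qed

end

theorem theorem1p3:
  fixes p :: nat
  assumes "prime p" and "p \<ge> 5"
  shows "rat_cong (\<Sum>k=0..p-1. (-1) ^ k * of_nat (franel k) * gen_harm 2 k)
                  (1 / 2 * bernpoly (p - 2) (1 / 3)) p
       \<and> rat_cong (\<Sum>k=0..p-1. (-1) ^ k * of_nat (franel k) * gen_harm 1 k)
                  (- 2 * of_int (Legendre (int p) 3) * fermat_quotient p 3) p"
proof -
  interpret prime_ge_5 p
    using assms by unfold_locales
  have range: "{0..p-1} = {..<p}"
    using p_gt_0 by auto
  have "(\<Sum>k=0..p-1. (-1) ^ k * of_nat (franel k) * gen_harm 2 k) \<simeq> 1 / 2 * bernpoly (p - 2) (1 / 3)"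
    unfolding range
    by (rule cong_p_trans[OF alternating_franel_harm_square_chi3_sum cong_p_sym[OF bernpoly_third_cong_p]])
  moreover have "(\<Sum>k=0..p-1. (-1) ^ k * of_nat (franel k) * gen_harm 1 k) \<simeq>
      - 2 * of_int (Legendre (int p) 3) * fermat_quotient p 3"
  proof -
    have "(\<Sum>k=0..p-1. (-1) ^ k * of_nat (franel k) * gen_harm 1 k) \<simeq>
        2 * (\<Sum>l=1..m. ((-3) ^ m - (-3) ^ (m - l)) / of_nat l)"
      unfolding range by (rule alternating_franel_harm_cong_p)
    also have "\<dots> \<simeq> 2 * (- of_int (chi3 (int p)) * fermat_quotient p 3)"
      by (intro cong_p_scale sum_diff_powers_cong_p) simp
    finally show ?thesis
      by (simp add: Legendre_3 mult.assoc)
  qed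
  ultimately show ?thesis
    by (simp only: cong_p_def)
qed

end
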